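(* For each $\sigma>0$ and $\mu\in\mathbb{R}$, there exists a unique solution $J=J^{\sigma,\mu}$ to $$(\mathrm R)\qquad \tfrac12J''(x)-\mu J'(x)+B(J)J(x)=0\ \text{ on }[0,1],\qquad J(0)=\begin{pmatrix}2\sigma\\ 0\end{pmatrix},\quad J(1)=\begin{pmatrix}0\\ 2\sigma\end{pmatrix}$$ which satisfies $$\max_{k\in\{0,1\}}\int_0^1|J_k(x)|\,dx\ \begin{cases}\le1,&\text{if }\sigma\ge\mu\coth\mu,\\ <1,&\text{if }\sigma<\mu\coth\mu.\end{cases}$$ Moreover, $J^{\sigma,\mu}\ge0$ in the sense that both of its components are nonnegative. Finally, set $B^{\sigma,\mu}=B(J^{\sigma,\mu})$. Then $B^{\sigma,\mu}$ has real eigenvalues $\lambda_1^{\sigma,\mu}<\lambda_0^{\sigma,\mu}\le0$; $\lambda_0^{\sigma,\mu}<0$ if and only if $\sigma>\mu\coth\mu$; the eigenvector $V_0^{\sigma,\mu}$ corresponding to $\lambda_0^{\sigma,\mu}$ can be chosen to be strictly positive (both components) with $(V_0^{\sigma,\mu})_0+(V_0^{\sigma,\mu})_1=1$; and the eigenvector $V_1^{\sigma,\mu}$ corresponding to $\lambda_1^{\sigma,\mu}$ can be chosen so that $(V_1^{\sigma,\mu})_0>0>(V_1^{\sigma,\mu})_1$ and $(V_1^{\sigma,\mu})_0-(V_1^{\sigma,\mu})_1=1$.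
   Context: Vectors in $\mathbb{R}^2$ are column vectors with components indexed by $0$ and $1$; eigenvectors are right eigenvectors. Given a continuously differentiable $J=\begin{pmatrix}J_0\\ J_1\end{pmatrix}:[0,1]\to\mathbb{R}^2$, set $$B(J)=\begin{pmatrix}-2\mu\sigma+\frac{J_0'(0)}2&-\frac{J_0'(1)}2\\[2pt] \frac{J_1'(0)}2&2\mu\sigma-\frac{J_1'(1)}2\end{pmatrix}.$$ A solution to $(\mathrm R)$ is a $J\in C^2([0,1];\mathbb{R}^2)$. When $\mu=0$, $\mu\coth\mu$ is taken to be $1$. *)

theory Defs
  imports "HOL-Analysis.Analysis"
begin

(* In the index type 2 the numeral 2 equals 0, so the two indices really are 0 and 1 and v $ 0,
   v $ 1 are the components. The library function vector puts the first list entry at index 1,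
   hence these explicit constructors. *)
definition col2 :: "real \<Rightarrow> real \<Rightarrow> real ^ 2" where
  "col2 a b = (\<chi> i. if i = 0 then a else b)"

(* rows (a b) and (c d) *)
definition mat2 :: "real \<Rightarrow> real \<Rightarrow> real \<Rightarrow> real \<Rightarrow> real ^ 2 ^ 2" where
  "mat2 a b c d = (\<chi> i j. if i = 0 then (if j = 0 then a else b) else (if j = 0 then c else d))"

lemma col2_nth [simp]: "col2 a b $ 0 = a" "col2 a b $ 1 = b"
  by (simp_all add: col2_def)

lemma mat2_nth [simp]:
  "mat2 a b c d $ 0 $ 0 = a" "mat2 a b c d $ 0 $ 1 = b"
  "mat2 a b c d $ 1 $ 0 = c" "mat2 a b c d $ 1 $ 1 = d"
  by (simp_all add: mat2_def)

lemma UNIV_index2: "(UNIV :: 2 set) = {0, 1}"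
  using UNIV_2 by auto

lemma mat2_mult_col2: "mat2 a b c d *v col2 x y = col2 (a * x + b * y) (c * x + d * y)"
  by (simp add: vec_eq_iff matrix_vector_mult_def UNIV_index2 col2_def mat2_def)

(* A function on [0,1] is represented by a total function of which only the values on {0..1}
   matter. Derivatives are taken within {0..1}: one-sided at the endpoints. *)
definition deriv01 :: "(real \<Rightarrow> real ^ 2) \<Rightarrow> real \<Rightarrow> real ^ 2" where
  "deriv01 J x = vector_derivative J (at x within {0..1})"

definition C1_01 :: "(real \<Rightarrow> real ^ 2) \<Rightarrow> bool" where
  "C1_01 J \<longleftrightarrow> J differentiable_on {0..1} \<and> continuous_on {0..1} (deriv01 J)"

definition C2_01 :: "(real \<Rightarrow> real ^ 2) \<Rightarrow> bool" where
  "C2_01 J \<longleftrightarrow> C1_01 J \<and> C1_01 (deriv01 J)"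

definition Bmat :: "real \<Rightarrow> real \<Rightarrow> (real \<Rightarrow> real ^ 2) \<Rightarrow> real ^ 2 ^ 2" where
  "Bmat \<sigma> \<mu> J = mat2
     (- 2 * \<mu> * \<sigma> + deriv01 J 0 $ 0 / 2)  (- (deriv01 J 1 $ 0 / 2))
     (deriv01 J 0 $ 1 / 2)                 (2 * \<mu> * \<sigma> - deriv01 J 1 $ 1 / 2)"

definition solves_R :: "real \<Rightarrow> real \<Rightarrow> (real \<Rightarrow> real ^ 2) \<Rightarrow> bool" where
  "solves_R \<sigma> \<mu> J \<longleftrightarrow> C2_01 J \<and>
     (\<forall>x\<in>{0..1}. (1/2) *\<^sub>R deriv01 (deriv01 J) x - \<mu> *\<^sub>R deriv01 J x + Bmat \<sigma> \<mu> J *v J x = 0) \<and>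
     J 0 = col2 (2 * \<sigma>) 0 \<and> J 1 = col2 0 (2 * \<sigma>)"

(* \<mu> coth \<mu>, continuously extended to \<mu> = 0 *)
definition mu_coth :: "real \<Rightarrow> real" where
  "mu_coth \<mu> = (if \<mu> = 0 then 1 else \<mu> * (cosh \<mu> / sinh \<mu>))"

definition mass_bound :: "real \<Rightarrow> real \<Rightarrow> (real \<Rightarrow> real ^ 2) \<Rightarrow> bool" where
  "mass_bound \<sigma> \<mu> J \<longleftrightarrow>
     (let m = (MAX k\<in>{0, 1}. integral {0..1} (\<lambda>x. \<bar>J x $ k\<bar>))
      in if \<sigma> \<ge> mu_coth \<mu> then m \<le> 1 else m < 1)"

definition is_eigenvector :: "real ^ 'n ^ 'n \<Rightarrow> real ^ 'n \<Rightarrow> real \<Rightarrow> bool" where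
  "is_eigenvector A v l \<longleftrightarrow> v \<noteq> 0 \<and> A *v v = l *\<^sub>R v"

definition is_eigenvalue :: "real ^ 'n ^ 'n \<Rightarrow> real \<Rightarrow> bool" where
  "is_eigenvalue A l \<longleftrightarrow> (\<exists>v. is_eigenvector A v l)"

end

theory Submission
  imports Defs
begin

text \<open>
  \<^bold>\<open>The nonlinear problem is a pair of scalar eigenvalue problems.\<close> The boundary values of \<open>J\<close> give
  \<open>B J(0) = \<sigma> J'(0) - 2 \<mu> \<sigma> J(0)\<close> and \<open>B J(1) = - \<sigma> J'(1) + 2 \<mu> \<sigma> J(1)\<close>. Hence if \<open>w\<close> is a left eigenvector of
  \<open>B = B(J)\<close> with eigenvalue \<open>l\<close>, the scalar function \<open>f = w \<bullet> J\<close> satisfies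
  \<open>f''/2 - \<mu> f' + l f = 0\<close>, \<open>f'(0) = (2 \<mu> + l/\<sigma>) f(0)\<close>, \<open>f'(1) = (2 \<mu> - l/\<sigma>) f(1)\<close>: a problem in which
  \<open>J\<close> no longer occurs, but the eigenvalue enters the boundary conditions. Writing
  \<open>f = exp (\<mu> x) g\<close> turns it into \<open>g'' = (\<mu>\<^sup>2 - 2 l) g\<close>, which is the predicate \<open>mode\<close> below.
  Conversely, two modes whose ratios \<open>g(1)/g(0)\<close> have opposite signs assemble to a
  solution (\<open>solution_from_modes\<close>).

  \<^bold>\<open>The modes.\<close> With \<open>v\<^sup>2 = \<mu>\<^sup>2 - 2 l\<close> and \<open>S = sinh v / v\<close>, a value \<open>l < 0\<close> belongs to a mode iff
  \<open>(2 \<sigma> S - cosh v)\<^sup>2 = 1 + \<mu>\<^sup>2 S\<^sup>2\<close>, and then \<open>g(1)/g(0) = \<mu> S + (2 \<sigma> S - cosh v)\<close> has the sign of the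
  chosen square root. The intermediate value theorem gives a root \<open>v\<^sub>1 > \<bar>\<mu>\<bar>\<close> with the negative sign
  and, if \<open>\<sigma> > \<mu> coth \<mu>\<close>, one with the positive sign between \<open>\<bar>\<mu>\<bar>\<close> and \<open>v\<^sub>1\<close>. Otherwise
  \<open>l = 0\<close>, \<open>g = exp (\<mu> x)\<close> replaces the latter (\<open>mode_pair_exists\<close>). The signs of \<open>g(1)/g(0)\<close> are those
  of the components of the left eigenvectors of \<open>B\<close>, whence the signs of the right eigenvectors;
  a maximum principle gives \<open>J \<ge> 0\<close>.

  \<^bold>\<open>The trace identity.\<close> For a test function \<open>\<phi>\<close> let \<open>T \<phi>\<close> be the vector of the integrals of
  \<open>\<phi> J\<^sub>0\<close> and \<open>\<phi> J\<^sub>1\<close>. Integration by parts gives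
  \<open>B (T \<phi> - (\<phi>(0), \<phi>(1))) = \<sigma> (- \<phi>'(0), \<phi>'(1)) - T (\<phi>''/2 + \<mu> \<phi>')\<close> for every solution. With \<open>\<phi> = 1\<close> it
  says that \<open>T 1 - (1, 1)\<close> lies in the kernel of \<open>B\<close>, from which the mass bound for the constructed
  solution follows.

  \<^bold>\<open>Uniqueness.\<close> If \<open>g\<close> is a mode with eigenvalue \<open>l < 0\<close>, then \<open>\<phi> = exp (- \<mu> x) g\<close> turns the identity
  into \<open>(B - l) (T \<phi> - (\<phi>(0), \<phi>(1))) = 0\<close>. By the maximum principle \<open>\<bar>\<phi>\<bar>\<close> attains its maximum over
  \<open>[0,1]\<close> only at the ends, and averaging against \<open>J\<^sub>0\<close>, \<open>J\<^sub>1\<close> of mass at most 1 makes it strictly smaller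
  (\<open>trace_gap\<close>), so \<open>T \<phi> \<noteq> (\<phi>(0), \<phi>(1))\<close>: the mass bound forces \<open>l\<close> to be an eigenvalue of \<open>B\<close>. If
  \<open>\<sigma> < \<mu> coth \<mu>\<close>, the strict mass bound and \<open>\<phi> = 1\<close> do the same for \<open>l = 0\<close>. If \<open>\<sigma> = \<mu> coth \<mu>\<close>, the value 0
  is a double eigenvalue of the scalar problem, and a generalized eigenfunction serves as a second
  test function. So every competitor has the same two eigenvalues, hence the same two scalar
  functions \<open>w \<bullet> J\<close>, and these determine \<open>J\<close>.
\<close>

section \<open>Linear algebra in the plane\<close>

lemma forall_index2: "(\<forall>i::2. P i) \<longleftrightarrow> P 0 \<and> P 1"
  using UNIV_index2 by (metis UNIV_I insert_iff singletonD)

lemma vec2_eq_iff: "(u :: real^2) = v \<longleftrightarrow> u $ 0 = v $ 0 \<and> u $ 1 = v $ 1"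
  by (simp add: vec_eq_iff forall_index2)

lemma inner_vec2: "(u :: real^2) \<bullet> v = u $ 0 * v $ 0 + u $ 1 * v $ 1"
  by (simp add: inner_vec_def UNIV_index2)

lemma matrix_vector_mult_nth2: "((A :: real^2^2) *v v) $ i = A $ i $ 0 * v $ 0 + A $ i $ 1 * v $ 1"
  by (simp add: matrix_vector_mult_def UNIV_index2)

lemma vec2_eq_zeroI:
  fixes u :: "real^2"
  assumes "p \<noteq> q" "col2 1 p \<bullet> u = 0" "col2 1 q \<bullet> u = 0"
  shows "u = 0"
proof -
  have "(p - q) * u $ 1 = 0" using assms(2,3) unfolding inner_vec2 col2_nth by algebra
  then have "u $ 1 = 0" using assms(1) by simp
  then show ?thesis using assms(2) by (simp add: inner_vec2 vec2_eq_iff)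
qed

text \<open>
  A nonzero row of the adjugate of \<open>A - l\<close> is a left null vector; if the adjugate vanishes, then \<open>A\<close>
  is the scalar \<open>l\<close> and every vector is one.
\<close>

lemma left_eigenvector_exists:
  fixes A :: "real^2^2"
  assumes "is_eigenvalue A l"
  shows "\<exists>w. w \<noteq> 0 \<and> (\<forall>u. w \<bullet> (A *v u) = l * (w \<bullet> u))"
proof -
  obtain v where v: "v \<noteq> 0" "A *v v = l *\<^sub>R v"
    using assms by (auto simp: is_eigenvalue_def is_eigenvector_def)
  define a b c d where "a = A $ 0 $ 0" and "b = A $ 0 $ 1" and "c = A $ 1 $ 0" and "d = A $ 1 $ 1"
  note abcd_defs = this
  have v': "(a - l) * v $ 0 + b * v $ 1 = 0" "c * v $ 0 + (d - l) * v $ 1 = 0"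
    using v(2) by (auto simp: vec2_eq_iff matrix_vector_mult_nth2 abcd_defs algebra_simps)
  have det: "(a - l) * (d - l) = b * c"
    using v(1) v' by (simp add: vec2_eq_iff) algebra
  have "\<exists>p q. (p \<noteq> 0 \<or> q \<noteq> 0) \<and> p * (a - l) + q * c = 0 \<and> p * b + q * (d - l) = 0"
  proof (cases "c = 0 \<and> a = l")
    case False
    then show ?thesis using det by (intro exI[of _ c] exI[of _ "l - a"]) (auto simp: algebra_simps)
  next
    case True
    show ?thesis
    proof (cases "d = l \<and> b = 0")
      case False
      then show ?thesis using True by (intro exI[of _ "d - l"] exI[of _ "- b"]) (auto simp: algebra_simps)
    qed (use True in auto)
  qed
  then obtain p q where pq: "p \<noteq> 0 \<or> q \<noteq> 0" "p * (a - l) + q * c = 0" "p * b + q * (d - l) = 0" by blast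
  show ?thesis
  proof (intro exI[of _ "col2 p q"] conjI allI)
    show "col2 p q \<noteq> 0" using pq(1) by (simp add: vec2_eq_iff)
    show "col2 p q \<bullet> (A *v u) = l * (col2 p q \<bullet> u)" for u
    proof -
      have "p * (a * u $ 0 + b * u $ 1) + q * (c * u $ 0 + d * u $ 1) = l * (p * u $ 0 + q * u $ 1)"
        using pq(2,3) by algebra
      then show ?thesis by (simp add: inner_vec2 matrix_vector_mult_nth2 abcd_defs)
    qed
  qed
qed

text \<open>
  The right eigenvector for \<open>l0\<close> is orthogonal to the left eigenvector \<open>(1, q)\<close> of the other
  eigenvalue, hence proportional to \<open>(- q, 1)\<close>, and likewise for \<open>l1\<close>. The normalizations are those
  that make the sum, respectively the difference, of the components equal to 1.
\<close>

lemma spectrum_from_left_eigenvectors: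
  fixes A :: "real^2^2"
  assumes left: "\<And>u. col2 1 p \<bullet> (A *v u) = l0 * (col2 1 p \<bullet> u)" "\<And>u. col2 1 q \<bullet> (A *v u) = l1 * (col2 1 q \<bullet> u)"
    and "p > 0" "q < 0"
  shows "{l. is_eigenvalue A l} = {l1, l0}"
    and "is_eigenvector A (col2 (- q / (1 - q)) (1 / (1 - q))) l0"
    and "is_eigenvector A (col2 (p / (1 + p)) (- 1 / (1 + p))) l1"
proof -
  show V0: "is_eigenvector A (col2 (- q / (1 - q)) (1 / (1 - q))) l0"
    unfolding is_eigenvector_def
  proof
    show "col2 (- q / (1 - q)) (1 / (1 - q)) \<noteq> 0" using assms by (simp add: vec2_eq_iff)
    have "A *v col2 (- q / (1 - q)) (1 / (1 - q)) - l0 *\<^sub>R col2 (- q / (1 - q)) (1 / (1 - q)) = 0"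
      by (rule vec2_eq_zeroI[of p q]) (use assms in \<open>simp_all only: inner_diff_right left inner_scaleR_right, simp_all add: inner_vec2\<close>)
    then show "A *v col2 (- q / (1 - q)) (1 / (1 - q)) = l0 *\<^sub>R col2 (- q / (1 - q)) (1 / (1 - q))" by simp
  qed
  show V1: "is_eigenvector A (col2 (p / (1 + p)) (- 1 / (1 + p))) l1"
    unfolding is_eigenvector_def
  proof
    show "col2 (p / (1 + p)) (- 1 / (1 + p)) \<noteq> 0" using assms by (simp add: vec2_eq_iff)
    have "A *v col2 (p / (1 + p)) (- 1 / (1 + p)) - l1 *\<^sub>R col2 (p / (1 + p)) (- 1 / (1 + p)) = 0"
      by (rule vec2_eq_zeroI[of p q]) (use assms in \<open>simp_all only: inner_diff_right left inner_scaleR_right, simp_all add: inner_vec2\<close>)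
    then show "A *v col2 (p / (1 + p)) (- 1 / (1 + p)) = l1 *\<^sub>R col2 (p / (1 + p)) (- 1 / (1 + p))" by simp
  qed
  have "l = l1 \<or> l = l0" if "is_eigenvector A v l" for v l
  proof (rule ccontr)
    assume "\<not> (l = l1 \<or> l = l0)"
    moreover have "l * (col2 1 p \<bullet> v) = l0 * (col2 1 p \<bullet> v)" "l * (col2 1 q \<bullet> v) = l1 * (col2 1 q \<bullet> v)"
      using left[of v] that by (simp_all add: is_eigenvector_def)
    ultimately show False using vec2_eq_zeroI[of p q v] assms that by (simp add: is_eigenvector_def)
  qed
  with V0 V1 show "{l. is_eigenvalue A l} = {l1, l0}" by (auto simp: is_eigenvalue_def)
qed

section \<open>Maximum principles and linear equations on the unit interval\<close>

text \<open>
  Positivity of the second derivative is only asked for where a maximum violating the bound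
  could sit. This covers solutions of \<open>u''/2 + \<mu> u' = c u\<close> (with \<open>c > 0\<close> and \<open>M > 0\<close>) as well as
  combinations of functions that satisfy different equations.
\<close>

lemma max_principle:
  fixes u u' u'' :: "real \<Rightarrow> real"
  assumes u: "\<And>x. (u has_real_derivative u' x) (at x)"
    and u': "\<And>x. (u' has_real_derivative u'' x) (at x)"
    and bd: "u 0 \<le> M" "u 1 \<le> M"
    and conv: "\<And>x. \<lbrakk>0 < x; x < 1; M \<le> u x; u' x = 0\<rbrakk> \<Longrightarrow> u'' x > 0"
    and x: "0 < x" "x < 1"
  shows "u x < M"
proof (rule ccontr)
  assume "\<not> u x < M"
  have "continuous_on {0..1} u"
    using u by (meson DERIV_isCont continuous_at_imp_continuous_on)
  then obtain z where z: "z \<in> {0..1}" "\<And>t. t \<in> {0..1} \<Longrightarrow> u t \<le> u z"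
    using continuous_attains_sup[of "{0..1::real}" u] by auto
  have "\<exists>y. 0 < y \<and> y < 1 \<and> (\<forall>t\<in>{0..1}. u t \<le> u y) \<and> M \<le> u y"
  proof (cases "u z \<le> u x")
    case True
    then show ?thesis using z x \<open>\<not> u x < M\<close> by (intro exI[of _ x]) force
  next
    case False
    then have "u z > M" using \<open>\<not> u x < M\<close> by simp
    with bd have "z \<noteq> 0" "z \<noteq> 1" by auto
    then show ?thesis using z \<open>u z > M\<close> by (intro exI[of _ z]) auto
  qed
  then obtain y where y: "0 < y" "y < 1" "\<And>t. t \<in> {0..1} \<Longrightarrow> u t \<le> u y" "M \<le> u y"
    by blast
  have "u' y = 0"
    by (rule DERIV_local_max[OF u, of "min y (1 - y)"]) (use y in \<open>auto simp: abs_less_iff\<close>)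
  then have "u'' y > 0" using conv y by blast
  from DERIV_pos_inc_right[OF u' this] obtain d where
    d: "d > 0" "\<And>h. 0 < h \<Longrightarrow> h < d \<Longrightarrow> u' y < u' (y + h)" by auto
  \<comment> \<open>\<open>u'\<close> vanishes at \<open>y\<close> and increases through it, so \<open>u\<close> exceeds its maximum just to the right of \<open>y\<close>\<close>
  define h where "h = min (d / 2) (1 - y)"
  have h: "0 < h" "h < d" "y + h \<le> 1" using d y by (auto simp: h_def)
  have "u y < u (y + h)"
  proof (rule DERIV_pos_imp_increasing_open[of y "y + h"])
    fix t assume t: "y < t" "t < y + h"
    then have "u' t > 0" using d(2)[of "t - y"] h \<open>u' y = 0\<close> by auto
    then show "\<exists>v. DERIV u t :> v \<and> v > 0" using u by blast
  next
    show "continuous_on {y..y+h} u"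
      using u by (meson DERIV_isCont continuous_at_imp_continuous_on)
  qed (use h in auto)
  with y(3)[of "y + h"] h y(1) show False by simp
qed

lemma abs_less_boundary_max:
  fixes \<phi> \<phi>' \<phi>'' :: "real \<Rightarrow> real"
  assumes \<phi>: "\<And>x. (\<phi> has_real_derivative \<phi>' x) (at x)"
    and \<phi>': "\<And>x. (\<phi>' has_real_derivative \<phi>'' x) (at x)"
    and ode: "\<And>x. \<phi>'' x / 2 + \<mu> * \<phi>' x = c * \<phi> x"
    and c: "c > 0" and pos: "\<phi> 0 \<noteq> 0" and x: "0 < x" "x < 1"
  shows "\<bar>\<phi> x\<bar> < max \<bar>\<phi> 0\<bar> \<bar>\<phi> 1\<bar>"
proof -
  let ?M = "max \<bar>\<phi> 0\<bar> \<bar>\<phi> 1\<bar>"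
  have M: "?M > 0" using pos by auto
  have "\<phi> x < ?M"
  proof (rule max_principle[OF \<phi> \<phi>' _ _ _ x])
    fix y assume "?M \<le> \<phi> y" "\<phi>' y = 0"
    then show "\<phi>'' y > 0" using ode[of y] M c mult_pos_pos[of c "\<phi> y"] by auto
  qed auto
  moreover have "- \<phi> x < ?M"
  proof (rule max_principle[where u = "\<lambda>x. - \<phi> x" and u' = "\<lambda>x. - \<phi>' x" and u'' = "\<lambda>x. - \<phi>'' x"])
    fix y assume "?M \<le> - \<phi> y" "- \<phi>' y = 0"
    then show "- \<phi>'' y > 0" using ode[of y] M c mult_pos_neg[of c "\<phi> y"] by auto
  qed (use x in \<open>auto intro!: DERIV_minus \<phi> \<phi>'\<close>)
  ultimately show ?thesis unfolding abs_less_iff by blast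
qed

text \<open>
  At a point where the combination is not positive, \<open>a1 g1 \<le> - a0 g0 < 0\<close>; as \<open>g1\<close> has the larger
  growth rate, the combination is strictly concave there, so it has no nonpositive interior minimum.
\<close>

lemma positive_combination:
  fixes g0 g1 :: "real \<Rightarrow> real"
  assumes g0: "\<And>x. (g0 has_real_derivative g0' x) (at x)" "\<And>x. (g0' has_real_derivative s0 * g0 x) (at x)"
    and g1: "\<And>x. (g1 has_real_derivative g1' x) (at x)" "\<And>x. (g1' has_real_derivative s1 * g1 x) (at x)"
    and s: "s0 < s1" "0 \<le> s1" and pos: "\<And>x. x \<in> {0..1} \<Longrightarrow> g0 x > 0" and a: "a0 > 0"
    and bd: "a0 * g0 0 + a1 * g1 0 \<ge> 0" "a0 * g0 1 + a1 * g1 1 \<ge> 0"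
    and x: "x \<in> {0..1}"
  shows "a0 * g0 x + a1 * g1 x \<ge> 0"
proof (cases "x = 0 \<or> x = 1")
  case False
  have "- (a0 * g0 x + a1 * g1 x) < 0"
  proof (rule max_principle[where u = "\<lambda>x. - (a0 * g0 x + a1 * g1 x)"
        and u' = "\<lambda>x. - (a0 * g0' x + a1 * g1' x)"
        and u'' = "\<lambda>x. - (a0 * (s0 * g0 x) + a1 * (s1 * g1 x))"])
    fix y :: real assume y: "0 < y" "y < 1" "0 \<le> - (a0 * g0 y + a1 * g1 y)"
    have "s1 * (a0 * g0 y + a1 * g1 y) \<le> 0"
      using y s by (simp add: mult_nonneg_nonpos)
    moreover have "(s1 - s0) * (a0 * g0 y) > 0"
      using y s a pos[of y] by simp
    ultimately show "- (a0 * (s0 * g0 y) + a1 * (s1 * g1 y)) > 0"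
      by (simp add: algebra_simps)
  qed (use x bd False in \<open>auto intro!: derivative_eq_intros g0 g1\<close>)
  then show ?thesis by simp
qed (use bd in auto)

lemma linear_ode1_zero:
  fixes y :: "real \<Rightarrow> real"
  assumes y: "\<And>x. x \<in> {0..1} \<Longrightarrow> (y has_real_derivative r * y x) (at x within {0..1})"
    and "y 0 = 0" and x: "x \<in> {0..1}"
  shows "y x = 0"
proof -
  have "((\<lambda>x. exp (- r * x) * y x) has_real_derivative 0) (at x within {0..1})" if "x \<in> {0..1}" for x
    using y[OF that] by (auto intro!: derivative_eq_intros)
  from has_field_derivative_zero_constant[OF convex_real_interval(5) this]
  obtain c where "\<And>x. x \<in> {0..1} \<Longrightarrow> exp (- r * x) * y x = c" by blast
  from this[of 0] this[OF x] show ?thesis using \<open>y 0 = 0\<close> by simp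
qed

text \<open>
  For \<open>l \<le> 0\<close> the characteristic roots \<open>\<mu> \<plusminus> v\<close> are real, so the operator splits into two real
  first-order factors, each of which has only the zero solution for zero initial value.
\<close>

lemma linear_ode2_zero:
  fixes h h' h'' :: "real \<Rightarrow> real"
  assumes h: "\<And>x. x \<in> {0..1} \<Longrightarrow> (h has_real_derivative h' x) (at x within {0..1})"
    and h': "\<And>x. x \<in> {0..1} \<Longrightarrow> (h' has_real_derivative h'' x) (at x within {0..1})"
    and ode: "\<And>x. x \<in> {0..1} \<Longrightarrow> h'' x / 2 - \<mu> * h' x + l * h x = 0"
    and l: "l \<le> 0" and init: "h 0 = 0" "h' 0 = 0" and x: "x \<in> {0..1}"
  shows "h x = 0"
proof -
  define v where "v = sqrt (\<mu>\<^sup>2 - 2 * l)"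
  have "0 \<le> \<mu>\<^sup>2 - 2 * l" using l by (smt (verit) zero_le_power2)
  then have v: "v * v = \<mu> * \<mu> - 2 * l" unfolding v_def by (simp add: power2_eq_square)
  have eq: "(\<mu> - v) * (h' x - (\<mu> + v) * h x) = h'' x - (\<mu> + v) * h' x" if "x \<in> {0..1}" for x
  proof -
    have "h'' x = 2 * \<mu> * h' x - 2 * l * h x" using ode[OF that] by simp
    moreover have "(\<mu> - v) * (\<mu> + v) = 2 * l" using v by (simp add: algebra_simps)
    ultimately show ?thesis by algebra
  qed
  have y: "h' x - (\<mu> + v) * h x = 0" if "x \<in> {0..1}" for x
  proof (rule linear_ode1_zero[of "\<lambda>x. h' x - (\<mu> + v) * h x" "\<mu> - v"])
    fix x :: real assume x: "x \<in> {0..1}"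
    have "((\<lambda>x. h' x - (\<mu> + v) * h x) has_real_derivative h'' x - (\<mu> + v) * h' x) (at x within {0..1})"
      by (intro DERIV_diff DERIV_cmult h[OF x] h'[OF x])
    then show "((\<lambda>x. h' x - (\<mu> + v) * h x) has_real_derivative
        (\<mu> - v) * (h' x - (\<mu> + v) * h x)) (at x within {0..1})"
      by (simp only: eq[OF x])
  qed (use that init in auto)
  show ?thesis
  proof (rule linear_ode1_zero[of h "\<mu> + v"])
    fix x :: real assume "x \<in> {0..1}"
    with y[of x] h[of x] show "(h has_real_derivative (\<mu> + v) * h x) (at x within {0..1})" by simp
  qed (use x init in auto)
qed

section \<open>The scalar eigenvalue problem\<close>

text \<open>
  A mode is a normalized solution of the scalar eigenvalue problem satisfied by \<open>w \<bullet> J\<close>, with the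
  factor \<open>exp (\<mu> x)\<close> removed. That factor shifts the boundary slopes \<open>2 \<mu> \<plusminus> l / \<sigma>\<close> to \<open>\<mu> \<plusminus> l / \<sigma>\<close>.
\<close>

definition mode :: "real \<Rightarrow> real \<Rightarrow> real \<Rightarrow> (real \<Rightarrow> real) \<Rightarrow> (real \<Rightarrow> real) \<Rightarrow> bool" where
  "mode \<sigma> \<mu> l g g' \<longleftrightarrow>
     (\<forall>x. (g has_real_derivative g' x) (at x)) \<and>
     (\<forall>x. (g' has_real_derivative (\<mu>\<^sup>2 - 2 * l) * g x) (at x)) \<and>
     g 0 = 1 \<and> g' 0 = \<mu> + l / \<sigma> \<and> g' 1 = (\<mu> - l / \<sigma>) * g 1"

text \<open>
  The quotient is extended to 0 because the search for roots starts at \<open>\<bar>\<mu>\<bar>\<close>, which may be 0.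
\<close>

definition sinhc :: "real \<Rightarrow> real" where
  "sinhc v = (if v = 0 then 1 else sinh v / v)"

lemma sinhc_mult: "v * sinhc v = sinh v"
  by (simp add: sinhc_def)

lemma sinhc_pos: "sinhc v > 0"
  by (cases v "0 :: real" rule: linorder_cases) (auto simp: sinhc_def divide_neg_neg)

lemma mu_coth_eq: "mu_coth \<mu> = cosh \<mu> / sinhc \<mu>"
  by (simp add: mu_coth_def sinhc_def)

lemma isCont_sinhc: "isCont sinhc v"
proof (cases "v = 0")
  case True
  have "(sinh has_real_derivative 1) (at 0)"
    by (auto intro!: derivative_eq_intros)
  then have "((\<lambda>v. sinh v / v) \<longlongrightarrow> (1::real)) (at 0)"
    by (simp add: DERIV_def)
  then have "(sinhc \<longlongrightarrow> 1) (at 0)"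
    by (rule Lim_transform_eventually) (auto simp: eventually_at_filter sinhc_def)
  with True show ?thesis by (simp add: isCont_def sinhc_def)
next
  case False
  then have "isCont (\<lambda>v. sinh v / v) v" by (intro continuous_intros) auto
  moreover have "\<forall>\<^sub>F u in nhds v. sinhc u = sinh u / u"
    using t1_space_nhds[OF False] by eventually_elim (simp add: sinhc_def)
  ultimately show ?thesis using isCont_cong[of sinhc "\<lambda>v. sinh v / v" v] by (simp add: eq_commute)
qed

lemma continuous_on_sinhc [continuous_intros]: "continuous_on A sinhc"
  by (simp add: continuous_at_imp_continuous_on isCont_sinhc)

text \<open>
  The boundary condition at 0 holds by the choice of \<open>p\<close>. The one at 1 reads
  \<open>v\<^sup>2 S + p C = (\<mu> - l / \<sigma>) (C + p S)\<close> with \<open>S = sinhc v\<close> and \<open>C = cosh v\<close>. Dividing out the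
  factor \<open>l\<close> leaves \<open>l S / \<sigma> = 2 \<sigma> S - 2 C\<close>, which is the root condition because
  \<open>C\<^sup>2 - 1 = v\<^sup>2 S\<^sup>2\<close>.
\<close>

lemma mode_of_root:
  assumes v: "v > 0" and \<sigma>: "\<sigma> > 0"
    and root: "(2 * \<sigma> * sinhc v - cosh v)\<^sup>2 = 1 + \<mu>\<^sup>2 * (sinhc v)\<^sup>2"
    and l: "l = (\<mu>\<^sup>2 - v\<^sup>2) / 2"
  defines "p \<equiv> \<mu> + l / \<sigma>"
  defines "g \<equiv> \<lambda>x. cosh (v * x) + p / v * sinh (v * x)"
    and "g' \<equiv> \<lambda>x. v * sinh (v * x) + p * cosh (v * x)"
  shows "mode \<sigma> \<mu> l g g'" and "g 1 = \<mu> * sinhc v + (2 * \<sigma> * sinhc v - cosh v)"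
proof -
  let ?S = "sinhc v" and ?C = "cosh v"
  have S: "?S > 0" by (rule sinhc_pos)
  have sinh: "sinh v = v * ?S" by (simp add: sinhc_mult)
  have CS: "?C\<^sup>2 = 1 + v\<^sup>2 * ?S\<^sup>2"
    using cosh_square_eq[of v] by (simp add: sinh power_mult_distrib)
  have v2: "v\<^sup>2 = \<mu>\<^sup>2 - 2 * l" using l by simp
  have "?S * (4 * \<sigma>\<^sup>2 * ?S - 4 * \<sigma> * ?C - 2 * l * ?S) = 0"
    using root CS v2 by algebra
  then have "4 * \<sigma>\<^sup>2 * ?S - 4 * \<sigma> * ?C = 2 * l * ?S" using S by simp
  then have lS: "l / \<sigma> * ?S = 2 * \<sigma> * ?S - 2 * ?C"
    using \<sigma> by (simp add: field_simps power2_eq_square)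
  have g1: "g 1 = ?C + p * ?S" using v by (simp add: g_def sinh)
  then show "g 1 = \<mu> * ?S + (2 * \<sigma> * ?S - ?C)"
    using lS by (simp add: p_def algebra_simps)
  define q where "q = l / \<sigma>"
  have v2': "v\<^sup>2 = \<mu>\<^sup>2 - 2 * \<sigma> * q" using l \<sigma> by (simp add: q_def field_simps)
  have qS: "q * ?S = 2 * \<sigma> * ?S - 2 * ?C" using lS by (simp add: q_def)
  have "g' 1 = (\<mu> - q) * g 1"
  proof -
    have "g' 1 = v\<^sup>2 * ?S + (\<mu> + q) * ?C"
      by (simp add: g'_def p_def q_def sinh power2_eq_square)
    moreover have "g 1 = ?C + (\<mu> + q) * ?S" using g1 by (simp add: p_def q_def)
    ultimately show ?thesis using v2' qS by algebra
  qed
  moreover have "(g has_real_derivative g' x) (at x)" for x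
    unfolding g_def g'_def using v by (auto intro!: derivative_eq_intros simp: field_simps)
  moreover have "(g' has_real_derivative (\<mu>\<^sup>2 - 2 * l) * g x) (at x)" for x
    unfolding g_def g'_def l using v
    by (auto intro!: derivative_eq_intros simp: field_simps power2_eq_square)
  ultimately show "mode \<sigma> \<mu> l g g'"
    by (simp add: mode_def g_def g'_def p_def q_def)
qed

text \<open>
  A combination of \<open>cosh (v x)\<close> and \<open>sinh (v x)\<close> interpolates between its end values with the positive weights
  \<open>sinh (v (1 - x)) / sinh v\<close> and \<open>sinh (v x) / sinh v\<close>.
\<close>

lemma cosh_sinh_combination_pos:
  fixes a v x :: real
  assumes v: "v > 0" and end1: "cosh v + a * sinh v > 0" and x: "x \<in> {0..1}"
  shows "cosh (v * x) + a * sinh (v * x) > 0"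
proof -
  have "sinh (v * (1 - x)) = sinh v * cosh (v * x) - cosh v * sinh (v * x)"
    by (simp add: algebra_simps sinh_diff)
  then have eq: "sinh v * (cosh (v * x) + a * sinh (v * x)) =
      sinh (v * (1 - x)) + (cosh v + a * sinh v) * sinh (v * x)"
    by (simp add: algebra_simps)
  have "sinh (v * (1 - x)) \<ge> 0" "sinh (v * x) \<ge> 0" using v x by auto
  moreover have "sinh (v * (1 - x)) > 0 \<or> sinh (v * x) > 0" using v x by (cases "x = 0") auto
  ultimately have "sinh v * (cosh (v * x) + a * sinh (v * x)) > 0"
    unfolding eq using end1
    by (metis add_nonneg_pos add_pos_nonneg less_imp_le mult_nonneg_nonneg mult_pos_pos)
  then show ?thesis using v by (simp add: zero_less_mult_iff)
qed

lemma mode_exp: "mode \<sigma> \<mu> 0 (\<lambda>x. exp (\<mu> * x)) (\<lambda>x. \<mu> * exp (\<mu> * x))"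
  unfolding mode_def by (auto intro!: derivative_eq_intros simp: power2_eq_square)

text \<open>
  With \<open>R = sqrt (1 + \<mu>\<^sup>2 S\<^sup>2)\<close> the root condition is \<open>cosh v \<plusminus> R - 2 \<sigma> S = 0\<close>. At \<open>v = \<bar>\<mu>\<bar>\<close> one has
  \<open>R = cosh \<mu>\<close>, so the left-hand side is \<open>- 2 \<sigma> S < 0\<close> for the lower sign, and for the upper sign
  \<open>2 cosh \<mu> - 2 \<sigma> S\<close>, which is negative iff \<open>\<sigma> > \<mu> coth \<mu>\<close>. At the root \<open>v1\<close> of the lower
  equation the upper left-hand side is \<open>2 R > 0\<close>, so searching up to \<open>v1\<close> gives \<open>v0 < v1\<close>, that is
  \<open>l1 < l0\<close>, without any monotonicity argument.
\<close>

lemma mode_pair_exists: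
  fixes \<sigma> \<mu> :: real
  assumes \<sigma>: "\<sigma> > 0"
  shows "\<exists>l0 l1 g0 g0' g1 g1'. mode \<sigma> \<mu> l0 g0 g0' \<and> mode \<sigma> \<mu> l1 g1 g1' \<and> l1 < l0 \<and> l0 \<le> 0 \<and>
     (l0 < 0 \<longleftrightarrow> \<sigma> > mu_coth \<mu>) \<and> (l0 = 0 \<longrightarrow> g0 = (\<lambda>x. exp (\<mu> * x))) \<and>
     (\<forall>x\<in>{0..1}. g0 x > 0) \<and> g1 1 < 0"
proof -
  define R where "R v = sqrt (1 + \<mu>\<^sup>2 * (sinhc v)\<^sup>2)" for v
  have R2: "(R v)\<^sup>2 = 1 + \<mu>\<^sup>2 * (sinhc v)\<^sup>2" for v
    unfolding R_def by (rule real_sqrt_pow2) auto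
  have R_gt: "\<bar>\<mu> * sinhc v\<bar> < R v" for v
    unfolding R_def by (rule real_less_rsqrt) (simp add: power_mult_distrib)
  have R_mu: "R \<bar>\<mu>\<bar> = cosh \<mu>"
    unfolding R_def
  proof (rule real_sqrt_unique)
    have "\<mu>\<^sup>2 * (sinhc \<bar>\<mu>\<bar>)\<^sup>2 = (sinh \<mu>)\<^sup>2"
      using sinhc_mult[of "\<bar>\<mu>\<bar>"] by (metis power2_abs power_mult_distrib sinh_real_abs)
    then show "(cosh \<mu>)\<^sup>2 = 1 + \<mu>\<^sup>2 * (sinhc \<bar>\<mu>\<bar>)\<^sup>2" using cosh_square_eq[of \<mu>] by simp
  qed simp
  have contR: "continuous_on A R" for A unfolding R_def by (intro continuous_intros)
  define h where "h e v = cosh v + e * R v - 2 * \<sigma> * sinhc v" for e v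
  have conth: "continuous_on A (h e)" for A e
    unfolding h_def by (intro continuous_intros contR)
  have h_mu: "h e \<bar>\<mu>\<bar> = (1 + e) * cosh \<mu> - 2 * \<sigma> * sinhc \<mu>" for e
  proof -
    have "sinhc \<bar>\<mu>\<bar> = sinhc \<mu>" by (simp add: sinhc_def abs_if)
    then show ?thesis by (simp add: h_def R_mu algebra_simps)
  qed
  \<comment> \<open>a point where \<open>cosh\<close> dominates: \<open>R + 2 \<sigma> S \<le> 1 + (\<bar>\<mu>\<bar> + 2 \<sigma>) S \<le> 1 + b S / 2 < 1 + cosh b / 2 < cosh b\<close>\<close>
  define b where "b = 2 * (\<bar>\<mu>\<bar> + 2 * \<sigma>) + 2"
  have b: "b > 2" "b > \<bar>\<mu>\<bar>" using \<sigma> by (auto simp: b_def)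
  have "h (- 1) b > 0"
  proof -
    have "R b \<le> 1 + \<bar>\<mu>\<bar> * sinhc b"
      unfolding R_def using sinhc_pos[of b]
      by (intro real_le_lsqrt) (auto simp: power2_sum power_mult_distrib)
    then have "h (- 1) b \<ge> cosh b - 1 - (\<bar>\<mu>\<bar> + 2 * \<sigma>) * sinhc b"
      by (simp add: h_def algebra_simps)
    moreover have "2 * ((\<bar>\<mu>\<bar> + 2 * \<sigma>) * sinhc b) \<le> b * sinhc b"
      using sinhc_pos[of b] by (simp add: b_def algebra_simps)
    moreover have "b * sinhc b < cosh b" by (simp add: sinhc_mult sinh_less_cosh_real)
    moreover have "cosh b > 2"
    proof -
      have "exp b \<ge> 1 + b + b\<^sup>2 / 2" using exp_lower_Taylor_quadratic[of b] b by simp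
      moreover have "b\<^sup>2 > 2 * 2" using b unfolding power2_eq_square by (intro mult_strict_mono) auto
      moreover have "2 * cosh b = exp b + exp (- b)" by (simp add: cosh_def)
      ultimately show ?thesis using b exp_gt_zero[of "- b"] by linarith
    qed
    ultimately show ?thesis by linarith
  qed
  moreover have h_neg: "h (- 1) \<bar>\<mu>\<bar> < 0" using \<sigma> sinhc_pos[of \<mu>] by (simp add: h_mu)
  ultimately obtain v1 where v1: "\<bar>\<mu>\<bar> \<le> v1" "h (- 1) v1 = 0"
    using IVT'[of "h (- 1)" "\<bar>\<mu>\<bar>" 0 b] b conth by (metis less_imp_le)
  have v1': "\<bar>\<mu>\<bar> < v1" using v1 h_neg by (cases "v1 = \<bar>\<mu>\<bar>") auto
  define l1 where "l1 = (\<mu>\<^sup>2 - v1\<^sup>2) / 2"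
  have e1: "2 * \<sigma> * sinhc v1 - cosh v1 = - R v1" using v1 by (simp add: h_def)
  have "v1 > 0" using v1' by simp
  note m1 = mode_of_root[OF \<open>v1 > 0\<close> \<sigma> _ l1_def, unfolded e1, simplified, OF R2]
  have l1: "l1 < 0"
    using power_strict_mono[OF v1', of 2] by (simp add: l1_def)
  obtain g1 g1' where g1: "mode \<sigma> \<mu> l1 g1 g1'" "g1 1 < 0"
    using that[OF m1(1)] m1(2) R_gt[of v1] by simp
  show ?thesis
  proof (cases "\<sigma> > mu_coth \<mu>")
    case False
    with mode_exp[of \<sigma> \<mu>] g1 l1 show ?thesis
      by (intro exI[of _ 0] exI[of _ l1] exI[of _ "\<lambda>x. exp (\<mu> * x)"]
          exI[of _ "\<lambda>x. \<mu> * exp (\<mu> * x)"] exI[of _ g1] exI[of _ g1']) auto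
  next
    case True
    then have "h 1 \<bar>\<mu>\<bar> < 0"
      using sinhc_pos[of \<mu>] by (simp add: h_mu mu_coth_eq field_simps)
    moreover have "h 1 v1 > 0" using e1 R_gt[of v1] by (simp add: h_def)
    ultimately obtain v0 where v0: "\<bar>\<mu>\<bar> \<le> v0" "v0 \<le> v1" "h 1 v0 = 0"
      using IVT'[of "h 1" "\<bar>\<mu>\<bar>" 0 v1] v1 conth by (metis less_imp_le)
    have v0': "\<bar>\<mu>\<bar> < v0" "v0 < v1"
      using v0 \<open>h 1 \<bar>\<mu>\<bar> < 0\<close> \<open>h 1 v1 > 0\<close> by (auto simp: order.strict_iff_order)
    define l0 where "l0 = (\<mu>\<^sup>2 - v0\<^sup>2) / 2"
    have e0: "2 * \<sigma> * sinhc v0 - cosh v0 = R v0" using v0 by (simp add: h_def)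
    have "v0 > 0" using v0' by simp
    note m0 = mode_of_root[OF \<open>v0 > 0\<close> \<sigma> _ l0_def, unfolded e0, OF R2]
    have l0: "l0 < 0"
      using power_strict_mono[OF v0'(1), of 2] by (simp add: l0_def)
    have "l1 < l0"
      using power_strict_mono[OF v0'(2), of 2] \<open>v0 > 0\<close> by (simp add: l0_def l1_def)
    have "cosh v0 + (\<mu> + l0 / \<sigma>) / v0 * sinh v0 > 0"
      using m0(2) R_gt[of v0] by simp
    with cosh_sinh_combination_pos[OF \<open>v0 > 0\<close>] m0(1)
    obtain g0 g0' where "mode \<sigma> \<mu> l0 g0 g0'" "\<forall>x\<in>{0..1}. g0 x > 0" by blast
    with g1 l0 \<open>l1 < l0\<close> True show ?thesis by (metis less_irrefl less_imp_le)
  qed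
qed

text \<open>
  The function \<open>f = exp (\<mu> x) g\<close> satisfies \<open>f''/2 - \<mu> f' + l f = 0\<close>.
\<close>

lemma mode_exp_shift:
  assumes "mode \<sigma> \<mu> l g g'"
  shows "((\<lambda>x. exp (\<mu> * x) * g x) has_real_derivative exp (\<mu> * x) * (g' x + \<mu> * g x)) (at x)"
    and "((\<lambda>x. exp (\<mu> * x) * (g' x + \<mu> * g x)) has_real_derivative
           2 * \<mu> * (exp (\<mu> * x) * (g' x + \<mu> * g x)) - 2 * l * (exp (\<mu> * x) * g x)) (at x)"
proof -
  have g: "(g has_real_derivative g' x) (at x)" "(g' has_real_derivative (\<mu>\<^sup>2 - 2 * l) * g x) (at x)"
    using assms by (auto simp: mode_def)
  show "((\<lambda>x. exp (\<mu> * x) * g x) has_real_derivative exp (\<mu> * x) * (g' x + \<mu> * g x)) (at x)"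
    by (auto intro!: derivative_eq_intros g simp: algebra_simps)
  show "((\<lambda>x. exp (\<mu> * x) * (g' x + \<mu> * g x)) has_real_derivative
           2 * \<mu> * (exp (\<mu> * x) * (g' x + \<mu> * g x)) - 2 * l * (exp (\<mu> * x) * g x)) (at x)"
    by (auto intro!: derivative_eq_intros g simp: algebra_simps power2_eq_square)
qed

section \<open>Derivatives on the closed interval\<close>

lemma C1_01_has_deriv:
  assumes "C1_01 J" "x \<in> {0..1}"
  shows "(J has_vector_derivative deriv01 J x) (at x within {0..1})"
  using assms unfolding C1_01_def deriv01_def differentiable_on_def
  by (simp add: vector_derivative_works[symmetric])

lemma deriv01_eqI:
  assumes "(J has_vector_derivative d) (at x within {0..1})" "x \<in> {0..1}"
  shows "deriv01 J x = d"
  unfolding deriv01_def using assms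
  by (intro vector_derivative_within_cbox[of 0 1, simplified]) auto

lemma C1_01I:
  assumes J: "\<And>x. x \<in> {0..1} \<Longrightarrow> (J has_vector_derivative J' x) (at x within {0..1})"
    and "continuous_on {0..1} J'"
  shows "C1_01 J"
  unfolding C1_01_def
proof
  show "J differentiable_on {0..1}"
    unfolding differentiable_on_def using J differentiableI_vector by blast
  show "continuous_on {0..1} (deriv01 J)"
    using assms deriv01_eqI by (subst continuous_on_cong[OF refl, of _ _ J']) auto
qed

lemma C2_01I:
  assumes J: "\<And>x. x \<in> {0..1} \<Longrightarrow> (J has_vector_derivative J' x) (at x within {0..1})"
    and J': "\<And>x. x \<in> {0..1} \<Longrightarrow> (J' has_vector_derivative J'' x) (at x within {0..1})"
    and J'': "continuous_on {0..1} J''"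
  shows "C2_01 J" and "\<And>x. x \<in> {0..1} \<Longrightarrow> deriv01 J x = J' x"
    and "\<And>x. x \<in> {0..1} \<Longrightarrow> deriv01 (deriv01 J) x = J'' x"
proof -
  show d: "deriv01 J x = J' x" if "x \<in> {0..1}" for x using deriv01_eqI J that by blast
  have d': "(deriv01 J has_vector_derivative J'' x) (at x within {0..1})" if "x \<in> {0..1}" for x
    by (rule has_vector_derivative_transform[OF that _ J'[OF that]]) (use d in auto)
  show "deriv01 (deriv01 J) x = J'' x" if "x \<in> {0..1}" for x using deriv01_eqI d' that by blast
  have "continuous_on {0..1} J'"
    unfolding continuous_on_eq_continuous_within
    using J' has_vector_derivative_continuous by blast
  with J J'' d' show "C2_01 J" unfolding C2_01_def by (blast intro: C1_01I)
qed

section \<open>The matrix B and the trace identity\<close>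

text \<open>
  Under the boundary conditions of the problem the columns of \<open>B\<close> are boundary data of \<open>K\<close>; for a
  left eigenvector \<open>w\<close> this is what yields the boundary conditions of \<open>w \<bullet> K\<close>.
\<close>

lemma Bmat_mult_eq:
  assumes "K 0 = col2 (2 * \<sigma>) 0" "K 1 = col2 0 (2 * \<sigma>)"
  shows "Bmat \<sigma> \<mu> K *v u =
    (u $ 0) *\<^sub>R ((1/2) *\<^sub>R deriv01 K 0 - \<mu> *\<^sub>R K 0) + (u $ 1) *\<^sub>R (\<mu> *\<^sub>R K 1 - (1/2) *\<^sub>R deriv01 K 1)"
  by (simp add: assms vec2_eq_iff matrix_vector_mult_nth2 Bmat_def algebra_simps)

lemma solves_R_D:
  assumes "solves_R \<sigma> \<mu> K"
  shows "x \<in> {0..1} \<Longrightarrow> (K has_vector_derivative deriv01 K x) (at x within {0..1})"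
    and "x \<in> {0..1} \<Longrightarrow> (deriv01 K has_vector_derivative deriv01 (deriv01 K) x) (at x within {0..1})"
    and "x \<in> {0..1} \<Longrightarrow> (1/2) *\<^sub>R deriv01 (deriv01 K) x - \<mu> *\<^sub>R deriv01 K x + Bmat \<sigma> \<mu> K *v K x = 0"
    and "K 0 = col2 (2 * \<sigma>) 0" and "K 1 = col2 0 (2 * \<sigma>)" and "continuous_on {0..1} K"
  using assms C1_01_has_deriv differentiable_imp_continuous_on
  unfolding solves_R_def C2_01_def C1_01_def by blast+

text \<open>
  Integration by parts of \<open>\<phi> (K''/2 - \<mu> K') = - \<phi> B K\<close>. In the boundary terms the values of \<open>K'\<close>
  are expressed through \<open>B\<close>, which merges them with \<open>B\<close> applied to the integral of \<open>\<phi> K\<close>.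
\<close>

lemma trace_identity:
  fixes \<phi> \<phi>' \<phi>'' :: "real \<Rightarrow> real"
  assumes K: "solves_R \<sigma> \<mu> K"
    and \<phi>: "\<And>x. (\<phi> has_real_derivative \<phi>' x) (at x)"
    and \<phi>': "\<And>x. (\<phi>' has_real_derivative \<phi>'' x) (at x)"
    and \<phi>'': "continuous_on {0..1} \<phi>''"
  shows "Bmat \<sigma> \<mu> K *v (integral {0..1} (\<lambda>x. \<phi> x *\<^sub>R K x) - col2 (\<phi> 0) (\<phi> 1)) =
    col2 (- \<sigma> * \<phi>' 0) (\<sigma> * \<phi>' 1) - integral {0..1} (\<lambda>x. (\<phi>'' x / 2 + \<mu> * \<phi>' x) *\<^sub>R K x)"
proof -
  note K_D = solves_R_D[OF K]
  let ?B = "Bmat \<sigma> \<mu> K" and ?K' = "deriv01 K" and ?L = "\<lambda>x. \<phi>'' x / 2 + \<mu> * \<phi>' x"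
  have cont: "continuous_on {0..1} \<phi>" "continuous_on {0..1} \<phi>'"
    using \<phi> \<phi>' by (meson DERIV_isCont continuous_at_imp_continuous_on)+
  have vd: "(\<phi> has_vector_derivative \<phi>' x) (at x within S)" "(\<phi>' has_vector_derivative \<phi>'' x) (at x within S)" for x S
    using \<phi>[of x] \<phi>'[of x]
    by (auto simp: has_real_derivative_iff_has_vector_derivative has_vector_derivative_at_within)
  define F where "F x = (1/2) *\<^sub>R (\<phi> x *\<^sub>R ?K' x - \<phi>' x *\<^sub>R K x) - \<mu> *\<^sub>R (\<phi> x *\<^sub>R K x)" for x
  have "(F has_vector_derivative - (\<phi> x *\<^sub>R (?B *v K x)) - ?L x *\<^sub>R K x) (at x within {0..1})"
    if x: "x \<in> {0..1}" for x
  proof -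
    have BK: "?B *v K x = \<mu> *\<^sub>R ?K' x - (1/2) *\<^sub>R deriv01 ?K' x"
      using K_D(3)[OF x] by (simp add: algebra_simps eq_neg_iff_add_eq_0)
    have scaleR: "((\<lambda>x. f x *\<^sub>R g x) has_vector_derivative f x *\<^sub>R g' + f' *\<^sub>R g x) (at x within {0..1})"
      if "(f has_vector_derivative f') (at x within {0..1})" "(g has_vector_derivative g') (at x within {0..1})"
      for f :: "real \<Rightarrow> real" and g :: "real \<Rightarrow> real^2" and f' g'
      using that by (intro has_vector_derivative_scaleR) (simp_all add: has_real_derivative_iff_has_vector_derivative)
    have half: "((\<lambda>x. c *\<^sub>R g x) has_vector_derivative c *\<^sub>R g') (at x within {0..1})"
      if "(g has_vector_derivative g') (at x within {0..1})" for c and g :: "real \<Rightarrow> real^2" and g'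
      using bounded_linear.has_vector_derivative[OF bounded_linear_scaleR_right that] .
    have "(F has_vector_derivative
        (1/2) *\<^sub>R ((\<phi> x *\<^sub>R deriv01 ?K' x + \<phi>' x *\<^sub>R ?K' x) - (\<phi>' x *\<^sub>R ?K' x + \<phi>'' x *\<^sub>R K x))
        - \<mu> *\<^sub>R (\<phi> x *\<^sub>R ?K' x + \<phi>' x *\<^sub>R K x)) (at x within {0..1})"
      unfolding F_def
      by (intro has_vector_derivative_diff half scaleR vd K_D(1,2)[OF x])
    then show ?thesis
      unfolding BK by (simp add: algebra_simps)
  qed
  then have "((\<lambda>x. - (\<phi> x *\<^sub>R (?B *v K x)) - ?L x *\<^sub>R K x) has_integral F 1 - F 0) {0..1}"
    by (intro fundamental_theorem_of_calculus) auto
  then have "F 1 - F 0 = integral {0..1} (\<lambda>x. - (\<phi> x *\<^sub>R (?B *v K x)) - ?L x *\<^sub>R K x)"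
    by (simp add: integral_unique)
  also have "\<dots> = - integral {0..1} (\<lambda>x. \<phi> x *\<^sub>R (?B *v K x)) - integral {0..1} (\<lambda>x. ?L x *\<^sub>R K x)"
  proof (subst integral_diff)
    have "continuous_on {0..1} (\<lambda>x. ?B *v K x)"
      using continuous_on_compose2[OF linear_continuous_on[OF matrix_vector_mul_bounded_linear] K_D(6)] by blast
    then show "(\<lambda>x. - (\<phi> x *\<^sub>R (?B *v K x))) integrable_on {0..1}"
      by (intro integrable_continuous_real continuous_intros cont)
    show "(\<lambda>x. ?L x *\<^sub>R K x) integrable_on {0..1}"
      by (intro integrable_continuous_real continuous_intros cont \<phi>'' K_D(6)) auto
  qed simp
  also have "integral {0..1} (\<lambda>x. \<phi> x *\<^sub>R (?B *v K x)) = ?B *v integral {0..1} (\<lambda>x. \<phi> x *\<^sub>R K x)"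
  proof -
    have "(\<lambda>x. \<phi> x *\<^sub>R K x) integrable_on {0..1}"
      by (intro integrable_continuous_real continuous_intros cont K_D(6))
    from integral_linear[OF this matrix_vector_mul_bounded_linear[of ?B]]
    show ?thesis by (simp add: o_def matrix_vector_mult_scaleR)
  qed
  finally have main: "F 1 - F 0 = - (?B *v integral {0..1} (\<lambda>x. \<phi> x *\<^sub>R K x)) - integral {0..1} (\<lambda>x. ?L x *\<^sub>R K x)" .
  have "F 1 - F 0 = - (?B *v col2 (\<phi> 0) (\<phi> 1)) - col2 (- \<sigma> * \<phi>' 0) (\<sigma> * \<phi>' 1)"
    unfolding Bmat_mult_eq[of K, OF K_D(4,5)] F_def K_D(4,5)
    by (simp add: vec2_eq_iff algebra_simps)
  with main show ?thesis by (simp add: matrix_vector_mult_diff_distrib algebra_simps)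
qed

lemma solution_kernel_moment:
  assumes K: "solves_R \<sigma> \<mu> K"
  shows "Bmat \<sigma> \<mu> K *v (integral {0..1} K - col2 1 1) = 0"
  using trace_identity[OF K, of "\<lambda>_. 1" "\<lambda>_. 0" "\<lambda>_. 0"] by (simp add: vec2_eq_iff)

text \<open>
  Say \<open>\<bar>\<phi>\<bar>\<close> attains its maximum at the end \<open>e\<close>. Averaging \<open>\<phi>\<close> against a component of mass at most 1
  reaches this maximum in absolute value only if the component vanishes on the interior, hence on
  \<open>[0,1]\<close>. But the component belonging to \<open>e\<close> has the value \<open>2 \<sigma>\<close> there.
\<close>

lemma trace_gap:
  fixes \<phi> :: "real \<Rightarrow> real"
  assumes K: "solves_R \<sigma> \<mu> K" and \<sigma>: "\<sigma> > 0"
    and mass: "\<And>k. integral {0..1} (\<lambda>x. \<bar>K x $ k\<bar>) \<le> 1"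
    and \<phi>: "continuous_on {0..1} \<phi>"
    and gap: "\<And>x. \<lbrakk>0 < x; x < 1\<rbrakk> \<Longrightarrow> \<bar>\<phi> x\<bar> < max \<bar>\<phi> 0\<bar> \<bar>\<phi> 1\<bar>"
  shows "integral {0..1} (\<lambda>x. \<phi> x *\<^sub>R K x) \<noteq> col2 (\<phi> 0) (\<phi> 1)"
proof
  assume eq: "integral {0..1} (\<lambda>x. \<phi> x *\<^sub>R K x) = col2 (\<phi> 0) (\<phi> 1)"
  define M where "M = max \<bar>\<phi> 0\<bar> \<bar>\<phi> 1\<bar>"
  note K_D = solves_R_D[OF K]
  obtain k e where e: "e \<in> {0..1}" "\<bar>\<phi> e\<bar> = M" "K e $ k = 2 * \<sigma>" "col2 (\<phi> 0) (\<phi> 1) $ k = \<phi> e"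
  proof (cases "\<bar>\<phi> 1\<bar> \<le> \<bar>\<phi> 0\<bar>")
    case True
    then show ?thesis using that[of 0 0] K_D(4) by (simp add: M_def)
  next
    case False
    then show ?thesis using that[of 1 1] K_D(5) by (simp add: M_def)
  qed
  have le: "\<bar>\<phi> x\<bar> \<le> M" if "x \<in> {0..1}" for x
    using gap[of x] that by (cases "x = 0 \<or> x = 1") (auto simp: M_def)
  have cK: "continuous_on {0..1} (\<lambda>x. K x $ k)" using K_D(6) by (intro continuous_intros)
  have int: "(\<lambda>x. M * \<bar>K x $ k\<bar>) integrable_on {0..1}" "(\<lambda>x. \<bar>\<phi> x * K x $ k\<bar>) integrable_on {0..1}"
    "(\<lambda>x. \<phi> x * K x $ k) integrable_on {0..1}"
    by (intro integrable_continuous_real continuous_intros cK \<phi>)+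
  have "(\<lambda>x. \<phi> x *\<^sub>R K x) integrable_on {0..1}"
    by (intro integrable_continuous_real continuous_intros \<phi> K_D(6))
  from integral_linear[OF this bounded_linear_vec_nth[of k]]
  have "integral {0..1} (\<lambda>x. \<phi> x * K x $ k) = \<phi> e" using eq e(4) by (simp add: o_def)
  moreover have "\<bar>integral {0..1} (\<lambda>x. \<phi> x * K x $ k)\<bar> \<le> integral {0..1} (\<lambda>x. \<bar>\<phi> x * K x $ k\<bar>)"
    using integral_norm_bound_integral[OF int(3,2)] by simp
  ultimately have "M \<le> integral {0..1} (\<lambda>x. \<bar>\<phi> x * K x $ k\<bar>)" using e(2) by simp
  moreover have "integral {0..1} (\<lambda>x. M * \<bar>K x $ k\<bar>) \<le> M"
    using mass[of k] e(2) by (simp add: mult_left_le abs_ge_zero flip: e(2))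
  ultimately have "integral {0..1} (\<lambda>x. M * \<bar>K x $ k\<bar> - \<bar>\<phi> x * K x $ k\<bar>) \<le> 0"
    using int by (simp add: integral_diff)
  moreover have nonneg: "M * \<bar>K x $ k\<bar> - \<bar>\<phi> x * K x $ k\<bar> \<ge> 0" if "x \<in> {0..1}" for x
    using mult_right_mono[OF le[OF that], of "\<bar>K x $ k\<bar>"] by (simp add: abs_mult)
  moreover have cont: "continuous_on {0..1} (\<lambda>x. M * \<bar>K x $ k\<bar> - \<bar>\<phi> x * K x $ k\<bar>)"
    by (intro continuous_intros cK \<phi>)
  ultimately have "integral (cbox 0 1) (\<lambda>x. M * \<bar>K x $ k\<bar> - \<bar>\<phi> x * K x $ k\<bar>) = 0"
    using integral_nonneg[OF integrable_continuous_real[OF cont]] by fastforce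
  then have zero: "\<forall>x\<in>{0..1}. M * \<bar>K x $ k\<bar> - \<bar>\<phi> x * K x $ k\<bar> = 0"
    using integral_eq_0_iff[of 0 1 "\<lambda>x. M * \<bar>K x $ k\<bar> - \<bar>\<phi> x * K x $ k\<bar>"] cont nonneg by auto
  have "K x $ k = 0" if "x \<in> {0<..<1}" for x
  proof -
    have "(M - \<bar>\<phi> x\<bar>) * \<bar>K x $ k\<bar> = 0" using zero that by (auto simp: abs_mult algebra_simps)
    then show ?thesis using gap[of x] that by (simp add: M_def)
  qed
  then have "K e $ k = 0"
    using continuous_constant_on_closure[of "{0<..<1}" "\<lambda>x. K x $ k" 0 e] cK e(1) by auto
  with e(3) \<sigma> show False by simp
qed

section \<open>Construction of the solution\<close>

text \<open>
  \<open>J\<close> is the inverse of the matrix with rows \<open>(1, exp \<mu> g\<^sub>i(1))\<close> applied to the vector of the functions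
  \<open>2 \<sigma> exp (\<mu> x) g\<^sub>i\<close>. The boundary conditions of the two modes make these rows left eigenvectors of
  \<open>B(J)\<close>, and since they span the plane, the system holds because it holds after taking the inner product
  with either row.
\<close>

lemma solution_from_modes:
  assumes \<sigma>: "\<sigma> > 0" and g0: "mode \<sigma> \<mu> l0 g0 g0'" and g1: "mode \<sigma> \<mu> l1 g1 g1'"
    and r: "g0 1 > 0" "g1 1 < 0"
  defines "c \<equiv> 2 * \<sigma> / (g0 1 - g1 1)"
  defines "J \<equiv> \<lambda>x. (exp (\<mu> * x) * g0 x) *\<^sub>R col2 (- g1 1 * c) (c * exp (- \<mu>))
                  + (exp (\<mu> * x) * g1 x) *\<^sub>R col2 (g0 1 * c) (- c * exp (- \<mu>))"
  shows "solves_R \<sigma> \<mu> J"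
    and "\<And>x. J x $ 0 + exp \<mu> * g0 1 * J x $ 1 = 2 * \<sigma> * (exp (\<mu> * x) * g0 x)"
    and "\<And>x. J x $ 0 + exp \<mu> * g1 1 * J x $ 1 = 2 * \<sigma> * (exp (\<mu> * x) * g1 x)"
    and "\<And>u. col2 1 (exp \<mu> * g0 1) \<bullet> (Bmat \<sigma> \<mu> J *v u) = l0 * (col2 1 (exp \<mu> * g0 1) \<bullet> u)"
    and "\<And>u. col2 1 (exp \<mu> * g1 1) \<bullet> (Bmat \<sigma> \<mu> J *v u) = l1 * (col2 1 (exp \<mu> * g1 1) \<bullet> u)"
proof -
  define a where "a = col2 (- g1 1 * c) (c * exp (- \<mu>))"
  define b where "b = col2 (g0 1 * c) (- c * exp (- \<mu>))"
  define w0 where "w0 = col2 1 (exp \<mu> * g0 1)"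
  define w1 where "w1 = col2 1 (exp \<mu> * g1 1)"
  have c: "c * (g0 1 - g1 1) = 2 * \<sigma>" using r by (simp add: c_def)
  have exp: "exp \<mu> * exp (- \<mu>) = 1" by (simp flip: exp_add)
  have wa: "w0 \<bullet> a = 2 * \<sigma>" "w1 \<bullet> a = 0" and wb: "w0 \<bullet> b = 0" "w1 \<bullet> b = 2 * \<sigma>"
    unfolding a_def b_def w0_def w1_def inner_vec2 col2_nth using c exp by algebra+
  have zero: "u = 0" if "w0 \<bullet> u = 0" "w1 \<bullet> u = 0" for u
    using vec2_eq_zeroI[of "exp \<mu> * g0 1" "exp \<mu> * g1 1" u] r that by (simp add: w0_def w1_def)
  define F where "F g x = exp (\<mu> * x) * g x" for g :: "real \<Rightarrow> real" and x
  define F' where "F' g g' x = exp (\<mu> * x) * (g' x + \<mu> * g x)" for g g' :: "real \<Rightarrow> real" and x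
  define F'' where "F'' l g g' x = 2 * \<mu> * F' g g' x - 2 * l * F g x" for l g g' x
  have dF: "(F g has_real_derivative F' g g' x) (at x within S)"
    "(F' g g' has_real_derivative F'' l g g' x) (at x within S)"
    if "mode \<sigma> \<mu> l g g'" for l g g' x S
    using mode_exp_shift[OF that, of x] unfolding F_def F'_def F''_def
    by (auto intro: has_field_derivative_at_within)
  have ends: "F g 0 = 1" "F' g g' 0 = 2 * \<mu> + l / \<sigma>" "F g 1 = exp \<mu> * g 1"
    "F' g g' 1 = (2 * \<mu> - l / \<sigma>) * (exp \<mu> * g 1)"
    if "mode \<sigma> \<mu> l g g'" for l g g'
  proof -
    have "g 0 = 1" "g' 0 = \<mu> + l / \<sigma>" "g' 1 = (\<mu> - l / \<sigma>) * g 1" using that by (auto simp: mode_def)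
    then show "F g 0 = 1" "F' g g' 0 = 2 * \<mu> + l / \<sigma>" "F g 1 = exp \<mu> * g 1"
      "F' g g' 1 = (2 * \<mu> - l / \<sigma>) * (exp \<mu> * g 1)"
      by (simp_all add: F_def F'_def) (simp add: algebra_simps)
  qed
  define J' where "J' x = F' g0 g0' x *\<^sub>R a + F' g1 g1' x *\<^sub>R b" for x
  define J'' where "J'' x = F'' l0 g0 g0' x *\<^sub>R a + F'' l1 g1 g1' x *\<^sub>R b" for x
  have J: "J x = F g0 x *\<^sub>R a + F g1 x *\<^sub>R b" for x by (simp add: J_def F_def a_def b_def)
  have wJ: "w0 \<bullet> J x = 2 * \<sigma> * F g0 x" "w1 \<bullet> J x = 2 * \<sigma> * F g1 x" for x
    by (simp_all add: J inner_add_right wa wb)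
  then show "J x $ 0 + exp \<mu> * g0 1 * J x $ 1 = 2 * \<sigma> * (exp (\<mu> * x) * g0 x)"
    "J x $ 0 + exp \<mu> * g1 1 * J x $ 1 = 2 * \<sigma> * (exp (\<mu> * x) * g1 x)" for x
    by (simp_all add: w0_def w1_def inner_vec2 F_def)
  have dJ: "(J has_vector_derivative J' x) (at x within {0..1})" for x
    unfolding J J'_def using dF[OF g0] dF[OF g1]
    by (auto intro!: derivative_eq_intros simp: J[abs_def])
  have dJ': "(J' has_vector_derivative J'' x) (at x within {0..1})" for x
    unfolding J''_def J'_def[abs_def] using dF[OF g0] dF[OF g1]
    by (auto intro!: derivative_eq_intros)
  have "continuous_on {0..1} J''"
  proof -
    have "continuous_on {0..1} (F g)" "continuous_on {0..1} (F' g g')" if "mode \<sigma> \<mu> l g g'" for l g g'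
      using dF[OF that] by (meson DERIV_continuous_on)+
    from this[OF g0] this[OF g1] show ?thesis
      unfolding J''_def F''_def by (intro continuous_intros)
  qed
  note C2 = C2_01I[OF dJ dJ' this, simplified]
  have J0: "J 0 = col2 (2 * \<sigma>) 0" and J1: "J 1 = col2 0 (2 * \<sigma>)"
  proof -
    have "J 0 - col2 (2 * \<sigma>) 0 = 0"
      by (rule zero) (simp_all add: inner_diff_right wJ ends[OF g0] ends[OF g1], simp_all add: w0_def w1_def inner_vec2)
    then show "J 0 = col2 (2 * \<sigma>) 0" by simp
    have "J 1 - col2 0 (2 * \<sigma>) = 0"
      by (rule zero) (simp_all add: inner_diff_right wJ ends[OF g0] ends[OF g1], simp_all add: w0_def w1_def inner_vec2)
    then show "J 1 = col2 0 (2 * \<sigma>)" by simp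
  qed
  have wJ': "w0 \<bullet> J' x = 2 * \<sigma> * F' g0 g0' x" "w1 \<bullet> J' x = 2 * \<sigma> * F' g1 g1' x"
    "w0 \<bullet> J'' x = 2 * \<sigma> * F'' l0 g0 g0' x" "w1 \<bullet> J'' x = 2 * \<sigma> * F'' l1 g1 g1' x" for x
    by (simp_all add: J'_def J''_def inner_add_right wa wb)
  have B: "Bmat \<sigma> \<mu> J *v u =
      (u $ 0) *\<^sub>R ((1/2) *\<^sub>R J' 0 - \<mu> *\<^sub>R J 0) + (u $ 1) *\<^sub>R (\<mu> *\<^sub>R J 1 - (1/2) *\<^sub>R J' 1)" for u
    unfolding Bmat_mult_eq[of J, OF J0 J1] using C2(2)[of 0] C2(2)[of 1] by simp
  have left: "w0 \<bullet> (Bmat \<sigma> \<mu> J *v u) = l0 * (w0 \<bullet> u)" "w1 \<bullet> (Bmat \<sigma> \<mu> J *v u) = l1 * (w1 \<bullet> u)" for u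
    unfolding B inner_add_right inner_diff_right inner_scaleR_right wJ wJ' ends[OF g0] ends[OF g1]
    using \<sigma> by (simp_all add: w0_def w1_def inner_vec2 field_simps)
  then show "col2 1 (exp \<mu> * g0 1) \<bullet> (Bmat \<sigma> \<mu> J *v u) = l0 * (col2 1 (exp \<mu> * g0 1) \<bullet> u)"
    "col2 1 (exp \<mu> * g1 1) \<bullet> (Bmat \<sigma> \<mu> J *v u) = l1 * (col2 1 (exp \<mu> * g1 1) \<bullet> u)" for u
    by (simp_all add: w0_def w1_def)
  have "(1/2) *\<^sub>R J'' x - \<mu> *\<^sub>R J' x + Bmat \<sigma> \<mu> J *v J x = 0" for x
    by (rule zero) (simp_all add: inner_add_right inner_diff_right left wJ wJ', simp_all add: F''_def algebra_simps)
  then show "solves_R \<sigma> \<mu> J"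
    unfolding solves_R_def using C2 J0 J1 by auto
qed

text \<open>
  The integral of \<open>2 \<sigma> exp (2 \<mu> x)\<close> is compared with the sum \<open>1 + exp (2 \<mu>)\<close> that total masses
  equal to 1 would give; the ratio is \<open>\<sigma> / (\<mu> coth \<mu>)\<close>. This is where the threshold enters the mass bound.
\<close>

lemma moment_of_exponential_mode:
  fixes K :: "real \<Rightarrow> real^2"
  assumes K: "continuous_on {0..1} K"
    and comb: "\<And>x. x \<in> {0..1} \<Longrightarrow> K x $ 0 + exp \<mu> * exp \<mu> * K x $ 1 = 2 * \<sigma> * (exp (\<mu> * x) * exp (\<mu> * x))"
  shows "integral {0..1} (\<lambda>x. K x $ 0) + exp \<mu> * exp \<mu> * integral {0..1} (\<lambda>x. K x $ 1) =
    \<sigma> / mu_coth \<mu> * (1 + exp \<mu> * exp \<mu>)"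
proof -
  have int: "(\<lambda>x. K x $ k) integrable_on {0..1}" for k
    using K by (intro integrable_continuous_real continuous_intros)
  have "integral {0..1} (\<lambda>x. K x $ 0) + exp \<mu> * exp \<mu> * integral {0..1} (\<lambda>x. K x $ 1) =
    integral {0..1} (\<lambda>x. K x $ 0 + exp \<mu> * exp \<mu> * K x $ 1)"
    using int by (subst integral_add) auto
  also have "\<dots> = integral {0..1} (\<lambda>x. 2 * \<sigma> * exp (2 * \<mu> * x))"
  proof (rule integral_cong)
    fix x :: real assume "x \<in> {0..1}"
    from comb[OF this] show "K x $ 0 + exp \<mu> * exp \<mu> * K x $ 1 = 2 * \<sigma> * exp (2 * \<mu> * x)"
      by (simp flip: exp_add)
  qed
  also have "\<dots> = \<sigma> / mu_coth \<mu> * (1 + exp \<mu> * exp \<mu>)"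
  proof (cases "\<mu> = 0")
    case False
    have "((\<lambda>x. 2 * \<sigma> * exp (2 * \<mu> * x)) has_integral
        \<sigma> / \<mu> * exp (2 * \<mu> * 1) - \<sigma> / \<mu> * exp (2 * \<mu> * 0)) {0..1}"
      using False by (intro fundamental_theorem_of_calculus)
        (auto intro!: derivative_eq_intros simp flip: has_real_derivative_iff_has_vector_derivative)
    from integral_unique[OF this]
    have "integral {0..1} (\<lambda>x. 2 * \<sigma> * exp (2 * \<mu> * x)) = \<sigma> / \<mu> * (exp \<mu> * exp \<mu> - 1)"
      by (simp only:) (simp add: right_diff_distrib flip: exp_add)
    moreover have "2 * sinh \<mu> * exp \<mu> = exp \<mu> * exp \<mu> - 1" "2 * cosh \<mu> * exp \<mu> = exp \<mu> * exp \<mu> + 1"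
      by (simp_all add: sinh_def cosh_def algebra_simps flip: exp_add)
    then have "(exp \<mu> * exp \<mu> - 1) * cosh \<mu> = (exp \<mu> * exp \<mu> + 1) * sinh \<mu>"
      by algebra
    then have "exp \<mu> * exp \<mu> - 1 = sinh \<mu> / cosh \<mu> * (1 + exp \<mu> * exp \<mu>)"
      using cosh_real_pos[of \<mu>] by (simp add: field_simps)
    ultimately show ?thesis using False by (simp add: mu_coth_def)
  qed (simp add: mu_coth_def)
  finally show ?thesis .
qed

section \<open>Eigenvalues forced by the mass bound\<close>

lemma mass_bound_iff:
  "mass_bound \<sigma> \<mu> J \<longleftrightarrow>
    (if \<sigma> \<ge> mu_coth \<mu> then \<forall>k. integral {0..1} (\<lambda>x. \<bar>J x $ k\<bar>) \<le> 1
     else \<forall>k. integral {0..1} (\<lambda>x. \<bar>J x $ k\<bar>) < 1)"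
  by (simp add: mass_bound_def Let_def forall_index2)

text \<open>
  The dual eigenfunction \<open>\<phi> = exp (- \<mu> x) g\<close> satisfies \<open>\<phi>''/2 + \<mu> \<phi>' = - l \<phi>\<close> with \<open>\<sigma> \<phi>'(0) = l \<phi>(0)\<close> and
  \<open>\<sigma> \<phi>'(1) = - l \<phi>(1)\<close>, so the trace identity exhibits \<open>T \<phi> - (\<phi>(0), \<phi>(1))\<close> as an eigenvector,
  provided that it is nonzero. Since \<open>- l > 0\<close>, the maximum principle applies to \<open>\<phi>\<close> and \<open>- \<phi>\<close>.
\<close>

lemma solution_eigenvalue_of_mode:
  assumes K: "solves_R \<sigma> \<mu> K" "mass_bound \<sigma> \<mu> K" and \<sigma>: "\<sigma> > 0"
    and g: "mode \<sigma> \<mu> l g g'" and l: "l < 0"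
  shows "is_eigenvalue (Bmat \<sigma> \<mu> K) l"
proof -
  have mass: "integral {0..1} (\<lambda>x. \<bar>K x $ k\<bar>) \<le> 1" for k
    using K(2) unfolding mass_bound_iff by (metis less_imp_le)
  define \<phi> where "\<phi> x = exp (- \<mu> * x) * g x" for x
  define \<phi>' where "\<phi>' x = exp (- \<mu> * x) * (g' x - \<mu> * g x)" for x
  define \<phi>'' where "\<phi>'' x = - 2 * \<mu> * \<phi>' x - 2 * l * \<phi> x" for x
  have dg: "(g has_real_derivative g' x) (at x)" "(g' has_real_derivative (\<mu>\<^sup>2 - 2 * l) * g x) (at x)" for x
    using g by (auto simp: mode_def)
  have d\<phi>: "(\<phi> has_real_derivative \<phi>' x) (at x)" for x
    unfolding \<phi>_def \<phi>'_def by (auto intro!: derivative_eq_intros dg simp: algebra_simps)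
  have d\<phi>': "(\<phi>' has_real_derivative \<phi>'' x) (at x)" for x
    unfolding \<phi>_def \<phi>''_def \<phi>'_def
    by (auto intro!: derivative_eq_intros dg simp: algebra_simps power2_eq_square)
  have cont: "continuous_on A \<phi>" "continuous_on A \<phi>'" for A
    using d\<phi> d\<phi>' by (meson DERIV_isCont continuous_at_imp_continuous_on)+
  have cont'': "continuous_on {0..1} \<phi>''" unfolding \<phi>''_def by (intro continuous_intros cont)
  have L: "\<phi>'' x / 2 + \<mu> * \<phi>' x = (- l) * \<phi> x" for x by (simp add: \<phi>''_def field_simps)
  have "g 0 = 1" "g' 0 = \<mu> + l / \<sigma>" "g' 1 = (\<mu> - l / \<sigma>) * g 1" using g by (auto simp: mode_def)
  then have bd: "\<phi> 0 = 1" "\<phi>' 0 = l / \<sigma> * \<phi> 0" "\<phi>' 1 = - l / \<sigma> * \<phi> 1"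
    by (simp_all add: \<phi>_def \<phi>'_def) (simp add: algebra_simps)
  define T where "T = integral {0..1} (\<lambda>x. \<phi> x *\<^sub>R K x)"
  have "Bmat \<sigma> \<mu> K *v (T - col2 (\<phi> 0) (\<phi> 1)) =
      col2 (- \<sigma> * \<phi>' 0) (\<sigma> * \<phi>' 1) - integral {0..1} (\<lambda>x. (- l) *\<^sub>R (\<phi> x *\<^sub>R K x))"
    using trace_identity[OF K(1) d\<phi> d\<phi>' cont''] unfolding T_def L by simp
  also have "\<dots> = l *\<^sub>R (T - col2 (\<phi> 0) (\<phi> 1))"
    unfolding integral_cmul bd(2,3) using \<sigma> by (simp add: T_def vec2_eq_iff algebra_simps)
  finally have "Bmat \<sigma> \<mu> K *v (T - col2 (\<phi> 0) (\<phi> 1)) = l *\<^sub>R (T - col2 (\<phi> 0) (\<phi> 1))" .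
  moreover have "T \<noteq> col2 (\<phi> 0) (\<phi> 1)"
    unfolding T_def
  proof (rule trace_gap[OF K(1) \<sigma> mass cont(1)])
    fix x :: real assume "0 < x" "x < 1"
    then show "\<bar>\<phi> x\<bar> < max \<bar>\<phi> 0\<bar> \<bar>\<phi> 1\<bar>"
      by (intro abs_less_boundary_max[OF d\<phi> d\<phi>' L]) (use l bd in auto)
  qed
  ultimately show ?thesis unfolding is_eigenvalue_def is_eigenvector_def
    by (intro exI[of _ "T - col2 (\<phi> 0) (\<phi> 1)"]) simp
qed

text \<open>
  A generalized eigenfunction at 0: the first-order term in \<open>l\<close> of a family of dual eigenfunctions
  starting from the constant 1. The two boundary slopes are compatible
  exactly at the threshold: multiplying the equation by \<open>exp (2 \<mu> x)\<close> and integrating gives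
  \<open>\<sigma> = \<mu> coth \<mu>\<close>.
\<close>

lemma critical_profile_exists:
  assumes \<sigma>: "\<sigma> > 0" "\<sigma> = mu_coth \<mu>"
  shows "\<exists>\<psi> \<psi>' \<psi>''. (\<forall>x. (\<psi> has_real_derivative \<psi>' x) (at x)) \<and> (\<forall>x. (\<psi>' has_real_derivative \<psi>'' x) (at x)) \<and>
    continuous_on {0..1} \<psi>'' \<and> (\<forall>x. \<psi>'' x / 2 + \<mu> * \<psi>' x = - 1) \<and> \<psi>' 0 = 1 / \<sigma> \<and> \<psi>' 1 = - 1 / \<sigma>"
proof (cases "\<mu> = 0")
  case True
  then show ?thesis using \<sigma>
    by (intro exI[of _ "\<lambda>x. x - x\<^sup>2"] exI[of _ "\<lambda>x. 1 - 2 * x"] exI[of _ "\<lambda>_. - 2"])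
      (auto intro!: derivative_eq_intros simp: mu_coth_def)
next
  case False
  \<comment> \<open>solving the first-order equation for \<open>\<psi>'\<close>, with \<open>C\<close> fixed by the slope at 0\<close>
  define C where "C = 1 / \<sigma> + 1 / \<mu>"
  have "C * exp (- 2 * \<mu>) - 1 / \<mu> = - 1 / \<sigma>"
  proof -
    define e where "e = exp (- \<mu>)"
    have "exp \<mu> * e = 1" "e > 0" by (simp_all add: e_def flip: exp_add)
    have e2: "exp (- 2 * \<mu>) = e * e" by (simp add: e_def flip: exp_add)
    have "2 * sinh \<mu> = exp \<mu> - e" "2 * cosh \<mu> = exp \<mu> + e"
      by (simp_all add: sinh_def cosh_def e_def)
    then have sc: "2 * sinh \<mu> * e = 1 - e * e" "2 * cosh \<mu> * e = 1 + e * e"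
      using \<open>exp \<mu> * e = 1\<close> by algebra+
    have "\<sigma> * sinh \<mu> = \<mu> * cosh \<mu>" using \<sigma>(2) False by (simp add: mu_coth_def)
    then have "\<sigma> * (1 - e * e) = \<mu> * (1 + e * e)" unfolding sc[symmetric] by algebra
    then have "(1 - e * e) / \<mu> = (1 + e * e) / \<sigma>" using \<sigma>(1) False by (simp add: field_simps)
    then show ?thesis unfolding e2 C_def by (simp add: diff_divide_distrib add_divide_distrib distrib_right)
  qed
  then show ?thesis using False
    by (intro exI[of _ "\<lambda>x. - x / \<mu> - C / (2 * \<mu>) * exp (- 2 * \<mu> * x)"]
        exI[of _ "\<lambda>x. C * exp (- 2 * \<mu> * x) - 1 / \<mu>"] exI[of _ "\<lambda>x. - 2 * \<mu> * C * exp (- 2 * \<mu> * x)"])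
      (auto intro!: derivative_eq_intros continuous_intros simp: C_def field_simps)
qed

text \<open>
  If the masses differ from \<open>(1, 1)\<close>, their difference is a null vector of \<open>B\<close>. They do differ
  below the threshold, by the strict mass bound. At the threshold with masses \<open>(1, 1)\<close>, the trace
  identity for the generalized eigenfunction has right-hand side \<open>T 1 - (1, 1) = 0\<close>; subtracting a constant
  from the test function does not affect this and makes it nonpositive, so that its minimum, attained only at the
  ends, becomes the maximum of its absolute value.
\<close>

lemma solution_zero_eigenvalue:
  assumes K: "solves_R \<sigma> \<mu> K" "mass_bound \<sigma> \<mu> K" and \<sigma>: "\<sigma> > 0" "\<sigma> \<le> mu_coth \<mu>"
  shows "is_eigenvalue (Bmat \<sigma> \<mu> K) 0"
proof (cases "integral {0..1} K = col2 1 1")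
  case False
  then show ?thesis using solution_kernel_moment[OF K(1)]
    unfolding is_eigenvalue_def is_eigenvector_def
    by (intro exI[of _ "integral {0..1} K - col2 1 1"]) simp
next
  case True
  have contK: "continuous_on {0..1} K" by (rule solves_R_D(6)[OF K(1)])
  have mass: "integral {0..1} (\<lambda>x. \<bar>K x $ k\<bar>) \<le> 1" for k
    using K(2) unfolding mass_bound_iff by (metis less_imp_le)
  have "mu_coth \<mu> \<le> \<sigma>"
  proof (rule ccontr)
    assume "\<not> mu_coth \<mu> \<le> \<sigma>"
    then have "integral {0..1} (\<lambda>x. \<bar>K x $ 0\<bar>) < 1" using K(2) by (simp add: mass_bound_iff)
    moreover have "integral {0..1} (\<lambda>x. K x $ 0) \<le> integral {0..1} (\<lambda>x. \<bar>K x $ 0\<bar>)"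
      by (intro integral_le integrable_continuous_real continuous_intros contK) auto
    moreover have "integral {0..1} (\<lambda>x. K x $ 0) = 1"
      using integral_linear[OF integrable_continuous_real[OF contK] bounded_linear_vec_nth[of 0]] True
      by (simp add: o_def)
    ultimately show False by simp
  qed
  with \<sigma> have "\<sigma> = mu_coth \<mu>" by simp
  then obtain \<psi> \<psi>' \<psi>'' where \<psi>: "\<And>x. (\<psi> has_real_derivative \<psi>' x) (at x)"
      "\<And>x. (\<psi>' has_real_derivative \<psi>'' x) (at x)" "continuous_on {0..1} \<psi>''"
      "\<And>x. \<psi>'' x / 2 + \<mu> * \<psi>' x = - 1" "\<psi>' 0 = 1 / \<sigma>" "\<psi>' 1 = - 1 / \<sigma>"
    using critical_profile_exists[OF \<sigma>(1)] by blast
  have cont\<psi>: "continuous_on {0..1} \<psi>"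
    using \<psi>(1) by (meson DERIV_isCont continuous_at_imp_continuous_on)
  obtain C where C: "\<And>x. x \<in> {0..1} \<Longrightarrow> \<psi> x \<le> C"
    using continuous_attains_sup[OF compact_Icc _ cont\<psi>] by fastforce
  define \<phi> where "\<phi> x = \<psi> x - C" for x
  have d\<phi>: "(\<phi> has_real_derivative \<psi>' x) (at x)" for x
    unfolding \<phi>_def by (auto intro!: derivative_eq_intros \<psi>(1))
  define T where "T = integral {0..1} (\<lambda>x. \<phi> x *\<^sub>R K x)"
  have "Bmat \<sigma> \<mu> K *v (T - col2 (\<phi> 0) (\<phi> 1)) =
      col2 (- 1) (- 1) - integral {0..1} (\<lambda>x. (- 1) *\<^sub>R K x)"
    using trace_identity[OF K(1) d\<phi> \<psi>(2,3)] \<sigma> unfolding T_def \<psi>(4-6) by simp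
  also have "\<dots> = 0" unfolding integral_cmul True by (simp add: vec2_eq_iff)
  finally have "Bmat \<sigma> \<mu> K *v (T - col2 (\<phi> 0) (\<phi> 1)) = 0" .
  moreover have "T \<noteq> col2 (\<phi> 0) (\<phi> 1)"
    unfolding T_def
  proof (rule trace_gap[OF K(1) \<sigma>(1) mass])
    show "continuous_on {0..1} \<phi>" unfolding \<phi>_def by (intro continuous_intros cont\<psi>)
    fix x :: real assume x: "0 < x" "x < 1"
    have np: "\<bar>\<phi> y\<bar> = - \<phi> y" if "y \<in> {0..1}" for y using C[OF that] by (simp add: \<phi>_def)
    have "- \<phi> x < max (- \<phi> 0) (- \<phi> 1)"
    proof (rule max_principle[where u = "\<lambda>x. - \<phi> x" and u' = "\<lambda>x. - \<psi>' x" and u'' = "\<lambda>x. - \<psi>'' x"])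
      show "- \<psi>'' y > 0" if "- \<psi>' y = 0" for y using \<psi>(4)[of y] that by simp
    qed (use x in \<open>auto intro!: DERIV_minus d\<phi> \<psi>(2)\<close>)
    then show "\<bar>\<phi> x\<bar> < max \<bar>\<phi> 0\<bar> \<bar>\<phi> 1\<bar>" using x by (simp add: np)
  qed
  ultimately show ?thesis unfolding is_eigenvalue_def is_eigenvector_def
    by (intro exI[of _ "T - col2 (\<phi> 0) (\<phi> 1)"]) simp
qed

text \<open>
  For a left eigenvector \<open>w\<close>, the functions \<open>w \<bullet> K\<close> and \<open>2 \<sigma> w\<^sub>0 exp (\<mu> x) g\<close> solve the same second-order
  equation with the same value and slope at 0, so they agree. Their values at 1 fix \<open>w\<close> up to a
  factor, and \<open>w\<^sub>0 \<noteq> 0\<close>, so \<open>w\<close> can be divided out.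
\<close>

lemma eigenvalue_determines_combination:
  assumes K: "solves_R \<sigma> \<mu> K" and \<sigma>: "\<sigma> > 0"
    and ev: "is_eigenvalue (Bmat \<sigma> \<mu> K) l" and l: "l \<le> 0"
    and g: "mode \<sigma> \<mu> l g g'" and x: "x \<in> {0..1}"
  shows "K x $ 0 + exp \<mu> * g 1 * K x $ 1 = 2 * \<sigma> * (exp (\<mu> * x) * g x)"
proof -
  note K_D = solves_R_D[OF K]
  obtain w where w: "w \<noteq> 0" "\<And>u. w \<bullet> (Bmat \<sigma> \<mu> K *v u) = l * (w \<bullet> u)"
    using left_eigenvector_exists[OF ev] by blast
  define c where "c = 2 * \<sigma> * w $ 0"
  define G where "G x = exp (\<mu> * x) * g x" for x
  define G' where "G' x = exp (\<mu> * x) * (g' x + \<mu> * g x)" for x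
  have dG: "(G has_real_derivative G' x) (at x within {0..1})"
    "(G' has_real_derivative 2 * \<mu> * G' x - 2 * l * G x) (at x within {0..1})" for x
    using mode_exp_shift[OF g, of x] unfolding G_def G'_def
    by (auto intro: has_field_derivative_at_within)
  have G0: "G 0 = 1" "G' 0 = 2 * \<mu> + l / \<sigma>" using g by (auto simp: G_def G'_def mode_def)
  have dw: "((\<lambda>x. w \<bullet> f x) has_real_derivative w \<bullet> d) F"
    if "(f has_vector_derivative d) F" for f :: "real \<Rightarrow> real^2" and d F
    using bounded_linear.has_vector_derivative[OF bounded_linear_inner_right that]
    by (simp add: has_real_derivative_iff_has_vector_derivative)
  have wK: "w \<bullet> K x = c * G x" if "x \<in> {0..1}" for x
  proof -
    have "w \<bullet> K x - c * G x = 0"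
    proof (rule linear_ode2_zero[where h = "\<lambda>x. w \<bullet> K x - c * G x"
          and h' = "\<lambda>x. w \<bullet> deriv01 K x - c * G' x" and \<mu> = \<mu> and l = l
          and h'' = "\<lambda>x. w \<bullet> deriv01 (deriv01 K) x - c * (2 * \<mu> * G' x - 2 * l * G x)"])
      fix x :: real assume x: "x \<in> {0..1}"
      show "((\<lambda>x. w \<bullet> K x - c * G x) has_real_derivative w \<bullet> deriv01 K x - c * G' x) (at x within {0..1})"
        by (intro DERIV_diff DERIV_cmult dw dG K_D x)
      show "((\<lambda>x. w \<bullet> deriv01 K x - c * G' x) has_real_derivative
          w \<bullet> deriv01 (deriv01 K) x - c * (2 * \<mu> * G' x - 2 * l * G x)) (at x within {0..1})"
        by (intro DERIV_diff DERIV_cmult dw dG K_D x)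
      have "w \<bullet> ((1/2) *\<^sub>R deriv01 (deriv01 K) x - \<mu> *\<^sub>R deriv01 K x + Bmat \<sigma> \<mu> K *v K x) = 0"
        using K_D(3)[OF x] by simp
      then show "(w \<bullet> deriv01 (deriv01 K) x - c * (2 * \<mu> * G' x - 2 * l * G x)) / 2
          - \<mu> * (w \<bullet> deriv01 K x - c * G' x) + l * (w \<bullet> K x - c * G x) = 0"
        by (simp add: inner_add_right inner_diff_right w(2) field_simps)
    next
      show "w \<bullet> K 0 - c * G 0 = 0" by (simp add: K_D inner_vec2 G0 c_def)
      have "w \<bullet> ((1/2) *\<^sub>R deriv01 K 0 - \<mu> *\<^sub>R K 0) = l * (w $ 0)"
        using w(2)[of "col2 1 0"] unfolding Bmat_mult_eq[of K, OF K_D(4,5)] by (simp add: inner_vec2)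
      then have "w \<bullet> deriv01 K 0 = 2 * l * w $ 0 + 4 * \<mu> * \<sigma> * w $ 0"
        by (simp add: inner_diff_right K_D(4) inner_vec2 algebra_simps)
      then show "w \<bullet> deriv01 K 0 - c * G' 0 = 0"
        using \<sigma> by (simp add: G0 c_def field_simps)
    qed (use l that in auto)
    then show ?thesis by simp
  qed
  from wK[of 1] have w1: "w $ 1 = w $ 0 * (exp \<mu> * g 1)"
    using \<sigma> by (simp add: K_D inner_vec2 c_def G_def algebra_simps)
  with w(1) have "w $ 0 \<noteq> 0" by (auto simp: vec2_eq_iff)
  moreover have "w $ 0 * (K x $ 0 + exp \<mu> * g 1 * K x $ 1) = w $ 0 * (2 * \<sigma> * (exp (\<mu> * x) * g x))"
    using wK[OF x] by (simp add: inner_vec2 w1 c_def G_def algebra_simps)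
  ultimately show ?thesis by simp
qed

section \<open>Existence, uniqueness and spectrum\<close>

theorem theorem1p2:
  fixes \<sigma> \<mu> :: real
  assumes "\<sigma> > 0"
  shows "\<exists>J :: real \<Rightarrow> real ^ 2.
      solves_R \<sigma> \<mu> J \<and> mass_bound \<sigma> \<mu> J \<and>
      (\<forall>K. solves_R \<sigma> \<mu> K \<and> mass_bound \<sigma> \<mu> K \<longrightarrow> (\<forall>x\<in>{0..1}. K x = J x)) \<and>
      (\<forall>x\<in>{0..1}. J x $ 0 \<ge> 0 \<and> J x $ 1 \<ge> 0) \<and>
      (\<exists>l0 l1 :: real.
         {l. is_eigenvalue (Bmat \<sigma> \<mu> J) l} = {l1, l0} \<and> l1 < l0 \<and> l0 \<le> 0 \<and>
         (l0 < 0 \<longleftrightarrow> \<sigma> > mu_coth \<mu>) \<and>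
         (\<exists>V\<^sub>0. is_eigenvector (Bmat \<sigma> \<mu> J) V\<^sub>0 l0 \<and>
            V\<^sub>0 $ 0 > 0 \<and> V\<^sub>0 $ 1 > 0 \<and> V\<^sub>0 $ 0 + V\<^sub>0 $ 1 = 1) \<and>
         (\<exists>V\<^sub>1. is_eigenvector (Bmat \<sigma> \<mu> J) V\<^sub>1 l1 \<and>
            V\<^sub>1 $ 0 > 0 \<and> 0 > V\<^sub>1 $ 1 \<and> V\<^sub>1 $ 0 - V\<^sub>1 $ 1 = 1))"
proof -
  note \<sigma> = assms
  obtain l0 l1 g0 g0' g1 g1' where g0: "mode \<sigma> \<mu> l0 g0 g0'" and g1: "mode \<sigma> \<mu> l1 g1 g1'"
    and l: "l1 < l0" "l0 \<le> 0" "l0 < 0 \<longleftrightarrow> \<sigma> > mu_coth \<mu>" "l0 = 0 \<longrightarrow> g0 = (\<lambda>x. exp (\<mu> * x))"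
    and pos: "\<And>x. x \<in> {0..1} \<Longrightarrow> g0 x > 0" and neg: "g1 1 < 0"
    using mode_pair_exists[OF \<sigma>, of \<mu>] by blast
  define p q where "p = exp \<mu> * g0 1" and "q = exp \<mu> * g1 1"
  have p: "p > 0" using pos[of 1] by (simp add: p_def)
  have q: "q < 0" using neg by (simp add: q_def mult_pos_neg)
  obtain J where J: "solves_R \<sigma> \<mu> J"
    and comb: "\<And>x. J x $ 0 + p * J x $ 1 = 2 * \<sigma> * (exp (\<mu> * x) * g0 x)"
      "\<And>x. J x $ 0 + q * J x $ 1 = 2 * \<sigma> * (exp (\<mu> * x) * g1 x)"
    and left: "\<And>u. col2 1 p \<bullet> (Bmat \<sigma> \<mu> J *v u) = l0 * (col2 1 p \<bullet> u)"
      "\<And>u. col2 1 q \<bullet> (Bmat \<sigma> \<mu> J *v u) = l1 * (col2 1 q \<bullet> u)"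
    using that solution_from_modes[OF \<sigma> g0 g1 pos[of 1] neg] unfolding p_def q_def by simp
  note spectrum = spectrum_from_left_eigenvectors[OF left p q]

  \<comment> \<open>up to positive factors \<open>exp (- \<mu> x) J\<^sub>0\<close> and \<open>exp (- \<mu> x) J\<^sub>1\<close> are \<open>g0(1) g1 - g1(1) g0\<close> and \<open>g0 - g1\<close>\<close>
  have nonneg: "J x $ 0 \<ge> 0 \<and> J x $ 1 \<ge> 0" if x: "x \<in> {0..1}" for x
  proof -
    have dg: "(g0 has_real_derivative g0' x) (at x)" "(g0' has_real_derivative (\<mu>\<^sup>2 - 2 * l0) * g0 x) (at x)"
      "(g1 has_real_derivative g1' x) (at x)" "(g1' has_real_derivative (\<mu>\<^sup>2 - 2 * l1) * g1 x) (at x)" for x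
      using g0 g1 by (auto simp: mode_def)
    have g_0: "g0 0 = 1" "g1 0 = 1" using g0 g1 by (auto simp: mode_def)
    have s: "\<mu>\<^sup>2 - 2 * l0 < \<mu>\<^sup>2 - 2 * l1" "0 \<le> \<mu>\<^sup>2 - 2 * l1"
      using l zero_le_power2[of \<mu>] by linarith+
    have "- g1 1 * g0 x + g0 1 * g1 x \<ge> 0"
      by (rule positive_combination[OF dg s pos _ _ _ x])
        (use neg pos[of 1] in \<open>auto simp: g_0\<close>)
    then have "0 \<le> (2 * \<sigma> * exp (\<mu> * x) * exp \<mu>) * (- g1 1 * g0 x + g0 1 * g1 x)"
      using \<sigma> by (intro mult_nonneg_nonneg) auto
    also have "\<dots> = (p - q) * J x $ 0"
      using comb[of x] unfolding p_def q_def by algebra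
    finally have "J x $ 0 \<ge> 0" using p q by (simp add: zero_le_mult_iff)
    have "1 * g0 x + (- 1) * g1 x \<ge> 0"
      by (rule positive_combination[OF dg s pos _ _ _ x])
        (use neg pos[of 1] in \<open>auto simp: g_0\<close>)
    then have "0 \<le> (2 * \<sigma> * exp (\<mu> * x)) * (1 * g0 x + (- 1) * g1 x)"
      using \<sigma> by (intro mult_nonneg_nonneg) auto
    also have "\<dots> = (p - q) * J x $ 1"
      using comb[of x] by algebra
    finally have "J x $ 1 \<ge> 0" using p q by (simp add: zero_le_mult_iff)
    with \<open>J x $ 0 \<ge> 0\<close> show ?thesis by simp
  qed

  have mass: "mass_bound \<sigma> \<mu> J"
  proof -
    define d where "d = integral {0..1} J - col2 1 1"
    have contJ: "continuous_on {0..1} J" by (rule solves_R_D(6)[OF J])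
    have abs_J: "integral {0..1} (\<lambda>x. \<bar>J x $ k\<bar>) = integral {0..1} (\<lambda>x. J x $ k)" for k
    proof (rule integral_cong)
      fix x :: real assume "x \<in> {0..1}"
      then have "J x $ k \<ge> 0" using nonneg forall_index2[of "\<lambda>k. J x $ k \<ge> 0"] by blast
      then show "\<bar>J x $ k\<bar> = J x $ k" by simp
    qed
    have int_J: "integral {0..1} (\<lambda>x. J x $ k) = integral {0..1} J $ k" for k
      using integral_linear[OF integrable_continuous_real[OF contJ] bounded_linear_vec_nth[of k]]
      by (simp add: o_def)
    have d_nth: "integral {0..1} (\<lambda>x. \<bar>J x $ k\<bar>) = 1 + d $ k" for k
      unfolding abs_J int_J using forall_index2[of "\<lambda>k. integral {0..1} J $ k = 1 + d $ k"]
      by (simp add: d_def)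
    have Bd: "Bmat \<sigma> \<mu> J *v d = 0" unfolding d_def by (rule solution_kernel_moment[OF J])
    \<comment> \<open>since \<open>l1 \<noteq> 0\<close>, the null vector \<open>d\<close> is a multiple of \<open>(- q, 1)\<close>: its components have equal signs\<close>
    have "l1 * (col2 1 q \<bullet> d) = 0" using left(2)[of d] Bd by simp
    then have d0: "d $ 0 = - q * d $ 1" using l by (simp add: inner_vec2)
    have d1: "col2 1 p \<bullet> d = (p - q) * d $ 1" by (simp add: inner_vec2 d0 algebra_simps)
    show ?thesis
    proof (cases "l0 = 0")
      case False
      have "l0 * (col2 1 p \<bullet> d) = 0" using left(1)[of d] Bd by simp
      then have "d $ 1 = 0" using False p q d1 by simp
      moreover have "mu_coth \<mu> < \<sigma>" using l False by simp
      ultimately show ?thesis using d0 by (simp add: mass_bound_iff d_nth forall_index2)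
    next
      case True
      then have "g0 = (\<lambda>x. exp (\<mu> * x))" using l by simp
      then have p_eq: "p = exp \<mu> * exp \<mu>" by (simp add: p_def)
      have "integral {0..1} (\<lambda>x. J x $ 0) + p * integral {0..1} (\<lambda>x. J x $ 1) = \<sigma> / mu_coth \<mu> * (1 + p)"
        unfolding p_eq
        by (rule moment_of_exponential_mode[OF contJ])
          (use comb(1) \<open>g0 = _\<close> p_eq in auto)
      then have "(p - q) * d $ 1 = (\<sigma> / mu_coth \<mu> - 1) * (1 + p)"
        unfolding d1[symmetric] int_J by (simp add: inner_vec2 d_def algebra_simps)
      moreover have "mu_coth \<mu> \<ge> \<sigma>" using True l by simp
      ultimately have sgn: "(\<sigma> = mu_coth \<mu> \<longrightarrow> (p - q) * d $ 1 = 0) \<and> (\<sigma> < mu_coth \<mu> \<longrightarrow> (p - q) * d $ 1 < 0)"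
        using \<sigma> p by (auto simp: mult_less_0_iff)
      show ?thesis
      proof (cases "\<sigma> = mu_coth \<mu>")
        case True
        then have "d $ 1 = 0" using sgn p q by simp
        then show ?thesis using True d0 by (simp add: mass_bound_iff d_nth forall_index2)
      next
        case False
        with \<open>mu_coth \<mu> \<ge> \<sigma>\<close> have lt: "\<sigma> < mu_coth \<mu>" by simp
        then have "d $ 1 < 0" using sgn p q by (simp add: mult_less_0_iff)
        moreover have "d $ 0 < 0" unfolding d0 using \<open>d $ 1 < 0\<close> q by (simp add: mult_neg_neg)
        ultimately show ?thesis using lt by (simp add: mass_bound_iff d_nth forall_index2)
      qed
    qed
  qed

  have unique: "K x = J x" if K: "solves_R \<sigma> \<mu> K" "mass_bound \<sigma> \<mu> K" and x: "x \<in> {0..1}" for K x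
  proof -
    have "is_eigenvalue (Bmat \<sigma> \<mu> K) l0"
    proof (cases "l0 = 0")
      case True
      then show ?thesis using solution_zero_eigenvalue[OF K \<sigma>] l by simp
    next
      case False
      then show ?thesis using solution_eigenvalue_of_mode[OF K \<sigma> g0] l by simp
    qed
    from eigenvalue_determines_combination[OF K(1) \<sigma> this l(2) g0 x]
    have K0: "K x $ 0 + p * K x $ 1 = 2 * \<sigma> * (exp (\<mu> * x) * g0 x)" by (simp add: p_def)
    have "l1 < 0" using l by simp
    have "is_eigenvalue (Bmat \<sigma> \<mu> K) l1"
      by (rule solution_eigenvalue_of_mode[OF K \<sigma> g1 \<open>l1 < 0\<close>])
    from eigenvalue_determines_combination[OF K(1) \<sigma> this _ g1 x] \<open>l1 < 0\<close>
    have K1: "K x $ 0 + q * K x $ 1 = 2 * \<sigma> * (exp (\<mu> * x) * g1 x)" by (simp add: q_def)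
    have "K x - J x = 0"
      by (rule vec2_eq_zeroI[of p q]) (use p q K0 K1 comb[of x] in \<open>auto simp: inner_vec2 algebra_simps\<close>)
    then show ?thesis by simp
  qed

  show ?thesis
  proof (intro exI[of _ J] conjI)
    show "\<exists>l0 l1 :: real.
         {l. is_eigenvalue (Bmat \<sigma> \<mu> J) l} = {l1, l0} \<and> l1 < l0 \<and> l0 \<le> 0 \<and>
         (l0 < 0 \<longleftrightarrow> \<sigma> > mu_coth \<mu>) \<and>
         (\<exists>V\<^sub>0. is_eigenvector (Bmat \<sigma> \<mu> J) V\<^sub>0 l0 \<and>
            V\<^sub>0 $ 0 > 0 \<and> V\<^sub>0 $ 1 > 0 \<and> V\<^sub>0 $ 0 + V\<^sub>0 $ 1 = 1) \<and>
         (\<exists>V\<^sub>1. is_eigenvector (Bmat \<sigma> \<mu> J) V\<^sub>1 l1 \<and>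
            V\<^sub>1 $ 0 > 0 \<and> 0 > V\<^sub>1 $ 1 \<and> V\<^sub>1 $ 0 - V\<^sub>1 $ 1 = 1)"
    proof (rule exI[of _ l0], rule exI[of _ l1], intro conjI)
      show "\<exists>V. is_eigenvector (Bmat \<sigma> \<mu> J) V l0 \<and> V $ 0 > 0 \<and> V $ 1 > 0 \<and> V $ 0 + V $ 1 = 1"
      proof (intro exI conjI)
        show "is_eigenvector (Bmat \<sigma> \<mu> J) (col2 (- q / (1 - q)) (1 / (1 - q))) l0" by (rule spectrum(2))
      qed (use q in \<open>simp_all add: field_simps\<close>)
      show "\<exists>V. is_eigenvector (Bmat \<sigma> \<mu> J) V l1 \<and> V $ 0 > 0 \<and> 0 > V $ 1 \<and> V $ 0 - V $ 1 = 1"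
      proof (intro exI conjI)
        show "is_eigenvector (Bmat \<sigma> \<mu> J) (col2 (p / (1 + p)) (- 1 / (1 + p))) l1" by (rule spectrum(3))
      qed (use p in \<open>simp_all add: field_simps\<close>)
    qed (fact spectrum(1) l(1-3))+
    show "\<forall>K. solves_R \<sigma> \<mu> K \<and> mass_bound \<sigma> \<mu> K \<longrightarrow> (\<forall>x\<in>{0..1}. K x = J x)"
      using unique by blast
    show "\<forall>x\<in>{0..1}. J x $ 0 \<ge> 0 \<and> J x $ 1 \<ge> 0" using nonneg by blast
  qed (fact J mass)+
qed

end
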